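(* Let $X$ be a real random variable with $0<\mathsf E|X|^{2+\delta}<\infty$ for some $\delta\in(0,1]$, and put $a=\mathsf E X$, $\sigma^2=\mathsf D X$ (variance), $\beta_r=\mathsf E|X|^r$ for $0<r\le 2+\delta$. Let $N$ be a non-negative integer-valued random variable, not degenerate at zero, which is infinitely divisible in the class of non-negative integer-valued random variables, and let $N\stackrel{d}{=}\{N_\lambda,Y\}$ be its representation as a compound Poisson sum, where $\lambda>0$, $N_\lambda\sim \mathrm{Pois}(\lambda)$ and $Y$ is a positive integer-valued random variable. Suppose that $\mathsf E Y^{2+\delta}<\infty$. Let $S_N\stackrel{d}{=}\{N,X\}$, $\widetilde S_N=(S_N-\mathsf E S_N)/\sqrt{\mathsf D S_N}$, and $Z\sim N(0,1)$. Then for every $\lambda>0$: (i) for any $a\in\mathbb R$, $$\rho(\widetilde S_N,Z)\le \frac{M(\delta)}{\lambda^{\delta/2}}\cdot\frac{\beta_{2+\delta}\,\mathsf E Y^{2+\delta}}{(\sigma^2\mathsf E Y+a^2\mathsf E Y^2)^{1+\delta/2}};$$ (ii) if $a=0$, $$\rho\Big(\frac{S_N}{\sqrt{\lambda\beta_2\mathsf E Y}},Z\Big)\le \tfrac12(1+\delta)(4+\delta)\,\frac{M(\delta)}{\lambda^{\delta/2}}\cdot\frac{\beta_{2+\delta}}{\beta_2^{1+\delta/2}}\cdot\frac{\mathsf E Y^{1+\delta/2}}{(\mathsf E Y)^{1+\delta/2}}.$$ In particular, if $\delta=1$ and $a=0$, then $$\rho\Big(\frac{S_N}{\sqrt{\lambda\beta_2\mathsf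 E Y}},Z\Big)\le \frac{1.5155}{\sqrt\lambda}\cdot\frac{\beta_3}{\beta_2^{3/2}}\cdot\frac{\mathsf E Y^{3/2}}{(\mathsf E Y)^{3/2}},\qquad \lambda>0.$$
   Context: $\rho(\xi,\eta)=\sup_{x\in\mathbb R}|\mathsf P(\xi<x)-\mathsf P(\eta<x)|$ is the Kolmogorov distance. For a non-negative integer-valued random variable $N$ and a random variable $X$, $\{N,X\}$ denotes a random variable distributed as $X_1+\dots+X_N$ (equal to $0$ when $N=0$), where $X_1,X_2,\dots$ are distributed as $X$ and $N,X_1,X_2,\dots$ are independent. A non-negative integer-valued random variable $N$ is infinitely divisible in the class of non-negative integer-valued random variables if for every $m\in\mathbb N$ there exist i.i.d. non-negative integer-valued $N_{m,1},\dots,N_{m,m}$ with $N\stackrel{d}{=}N_{m,1}+\dots+N_{m,m}$. If such an $N$ is not degenerate at zero, it can be written as $\{N_\lambda,Y\}$ with some $\lambda>0$, $N_\lambda\sim\mathrm{Pois}(\lambda)$ and a positive integer-valued $Y$. Constants: for $\delta\in(0,1]$ and $s\ge0$, $C_s(\delta)$ denotes a constant depending only on $s,\delta$ for which the structured Berry–Esseen inequality for i.i.d. summands holds: for all $n$ and all i.i.d. $Y_1,\dots,Y_n$ with $\mathsf E Y_1=0$, $\mathsf E Y_1^2=\sigma_1^2>0$, $\mathsf E|Y_1|^{2+\delta}<\infty$, $$\sup_x\big|\mathsf P(Y_1+\dots+Y_n<x\sigma_1\sqrt n)-\Phi(x)\big|\le \frac{C_s(\delta)}{n^{\delta/2}}\Big(\frac{\mathsf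 E|Y_1|^{2+\delta}}{\sigma_1^{2+\delta}}+s\Big),$$ with $\Phi$ the standard normal d.f.; and $M(\delta)=\min_{0\le s\le1}C_s(\delta)$. For $\delta=1$ the values from the literature satisfy $C_{0.646}(1)\le0.3031$, so $M(1)\le0.3031$. *)

theory Defs
  imports "HOL-Probability.Probability"
begin

definition kolmogorov_dist :: "'a measure \<Rightarrow> ('a \<Rightarrow> real) \<Rightarrow> 'b measure \<Rightarrow> ('b \<Rightarrow> real) \<Rightarrow> real" where
  "kolmogorov_dist P \<xi> Q \<eta> =
     (SUP x::real. \<bar>\<P>(\<omega> in P. \<xi> \<omega> < x) - \<P>(\<omega> in Q. \<eta> \<omega> < x)\<bar>)"

(* The law of X_1 + ... + X_N for N with law \<nu> and X_1, X_2, ... with law \<mu>, all independent,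
   realised on the product space. As a codomain, \<mu> only supplies its sigma-algebra
   (borel for real summands, discrete for integer-valued ones). *)
definition random_sum_law :: "nat measure \<Rightarrow> 'b::comm_monoid_add measure \<Rightarrow> 'b measure" where
  "random_sum_law \<nu> \<mu> =
     distr (\<nu> \<Otimes>\<^sub>M (\<Pi>\<^sub>M i\<in>(UNIV::nat set). \<mu>)) \<mu> (\<lambda>(n, x). \<Sum>i = 1..n. x i)"

(* Infinite divisibility of a law on the non-negative integers within the class of such laws. *)
definition inf_divisible_nat :: "nat measure \<Rightarrow> bool" where
  "inf_divisible_nat \<mu> \<longleftrightarrow>
     (\<forall>m\<ge>1. \<exists>\<nu>::nat pmf.
        \<mu> = distr (\<Pi>\<^sub>M i\<in>{1..m::nat}. measure_pmf \<nu>) (count_space UNIV) (\<lambda>k. \<Sum>i = 1..m. k i))"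

(* c is admissible as C_s(\<delta>) in the structured Berry-Esseen inequality.
   Taking nat => real as the type of outcomes loses no generality: every finite i.i.d. sample of
   real random variables has the same joint law as a sample defined on a product space of this type.
   Integrability of Y 1 and of its square follows from that of the (2+\<delta>)-th absolute moment. *)
definition berry_esseen_const :: "real \<Rightarrow> real \<Rightarrow> real \<Rightarrow> bool" where
  "berry_esseen_const s \<delta> c \<longleftrightarrow>
     (\<forall>(P::(nat \<Rightarrow> real) measure) (Y::nat \<Rightarrow> (nat \<Rightarrow> real) \<Rightarrow> real) (n::nat) (\<sigma>1::real).
        prob_space P \<longrightarrow> n \<ge> 1 \<longrightarrow>
        prob_space.indep_vars P (\<lambda>_. borel) Y {1..n} \<longrightarrow>
        (\<forall>i\<in>{1..n}. distr P borel (Y i) = distr P borel (Y 1)) \<longrightarrow>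
        prob_space.expectation P (Y 1) = 0 \<longrightarrow>
        \<sigma>1 > 0 \<longrightarrow> prob_space.expectation P (\<lambda>\<omega>. (Y 1 \<omega>)\<^sup>2) = \<sigma>1\<^sup>2 \<longrightarrow>
        integrable P (\<lambda>\<omega>. \<bar>Y 1 \<omega>\<bar> powr (2 + \<delta>)) \<longrightarrow>
        (SUP x::real. \<bar>\<P>(\<omega> in P. (\<Sum>i = 1..n. Y i \<omega>) < x * \<sigma>1 * sqrt (real n))
                        - cdf std_normal_distribution x\<bar>)
          \<le> c / real n powr (\<delta> / 2) *
             (prob_space.expectation P (\<lambda>\<omega>. \<bar>Y 1 \<omega>\<bar> powr (2 + \<delta>)) / \<sigma>1 powr (2 + \<delta>) + s))"

(* M(\<delta>). Admissible constants are positive, so the infimum is a genuine one; it coincides with the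
   minimum over s whenever the latter is attained. *)
definition min_const :: "(real \<Rightarrow> real \<Rightarrow> real) \<Rightarrow> real \<Rightarrow> real" where
  "min_const C \<delta> = (INF s\<in>{0..1}. C s \<delta>)"

end

(* The total S is compound Poisson: S has the law of W_1 + ... + W_K with K ~ Pois(lam) and W = {Y, X}.
   For every n it is therefore a sum of n i.i.d. copies of V_n, compound Poisson with intensity lam / n.
   The Berry-Esseen inequality applied to this sum bounds the distance by
   C_s / n^(d/2) * (E|V_n - E V_n|^(2+d) / (Var V_n)^(1+d/2) + s), where Var V_n = (lam / n) E W^2 and
   E|V_n - E V_n|^(2+d) = (lam / n) (E|W|^(2+d) + o(1)). As n tends to infinity, the term with s disappears
   and C_s lam^(-d/2) E|W|^(2+d) / (E W^2)^(1+d/2) remains. Then E|W|^(2+d) is bounded by convexity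
   in case (i), and in case (ii) by summing a second-order Taylor inequality for |.|^(2+d). *)
theory Submission
  imports Defs
begin

section \<open>Inequalities for real powers\<close>

text \<open>Berry-Esseen speaks of a deterministic number of summands, while N is random; the
  divisibility of a compound Poisson law supplies such a number, as large as desired. The powers of
  n balance exactly: with h = lam / n the Lyapunov ratio of V_n is of order h / h^(1+d/2) = (n /
  lam)^(d/2), which cancels n^(-d/2) and leaves lam^(-d/2). Hence no constant may be lost in E|V_n -
  E V_n|^(2+d) <= h (E|W|^(2+d) + o(1)): the centring is split off with a weight tending to 0, and
  the convexity bound is crude only when there are two or more jumps, which contributes O(h^2). This
  upper bound is all that the limit needs.

  Equalities of laws (the n-fold split, and {{N_lam, Y}, X} = {N_lam, {Y, X}}) come from
  characteristic functions and Levy's uniqueness theorem.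

  Case (ii) gains because a centred sum of n terms has a moment of order n^(1+d/2) instead of
  n^(2+d). Taylor's inequality gives the factor (2+d)(1+d)/2 + 1, which is below the factor
  (1+d)(4+d)/2 of the theorem by exactly d.\<close>

lemma square_powr_half:
  fixes x d :: real
  shows "(x\<^sup>2) powr (1 + d / 2) = \<bar>x\<bar> powr (2 + d)"
proof -
  have "(x\<^sup>2) powr (1 + d / 2) = (\<bar>x\<bar> powr 2) powr (1 + d / 2)" by simp
  also have "\<dots> = \<bar>x\<bar> powr (2 * (1 + d / 2))" by (rule powr_powr)
  also have "2 * (1 + d / 2) = 2 + d" by simp
  finally show ?thesis .
qed

section \<open>Convexity of real powers: Jensen's inequality for sums and expectations\<close>

text \<open>Convexity of \<open>t powr k\<close> as a tangent line at \<open>u\<close>, namely y^k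
  >= u^k + k u^(k-1) (y - u), rearranged so that it is Young's inequality for the conjugate
  exponents k and k / (k - 1). Averaging over \<open>y\<close> with \<open>u\<close> the mean yields
  Jensen's inequality, for finite sums and for expectations alike.\<close>

lemma powr_tangent_bound:
  fixes u y k :: real
  assumes "u \<ge> 0" "y \<ge> 0" "k \<ge> 1"
  shows "k * y * u powr (k - 1) \<le> y powr k + (k - 1) * u powr k"
proof (cases "k = 1")
  case True
  then show ?thesis using assms by simp
next
  case False
  define q where "q = k / (k - 1)"
  have k: "k > 1" using assms False by simp
  have q: "q > 1" "1 / k + 1 / q = 1" using k by (auto simp: q_def field_simps)
  have "y * u powr (k - 1) \<le> y powr k / k + (u powr (k - 1)) powr q / q"
    by (rule Youngs_inequality) (use k q assms in auto)
  also have "(u powr (k - 1)) powr q = u powr k"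
    using k by (simp add: powr_powr q_def)
  also have "y powr k / k + u powr k / q = (y powr k + (k - 1) * u powr k) / k"
    using k by (simp add: q_def field_simps)
  finally show ?thesis using k by (simp add: field_simps)
qed

lemma powr_weighted_mean_le:
  fixes w y :: "'i \<Rightarrow> real"
  assumes k: "k \<ge> 1" and w: "\<And>i. i \<in> I \<Longrightarrow> w i \<ge> 0" "sum w I = 1"
    and y: "\<And>i. i \<in> I \<Longrightarrow> y i \<ge> 0"
  shows "(\<Sum>i\<in>I. w i * y i) powr k \<le> (\<Sum>i\<in>I. w i * y i powr k)"
proof -
  define u where "u = (\<Sum>i\<in>I. w i * y i)"
  have u: "u \<ge> 0" unfolding u_def using w y by (intro sum_nonneg) auto
  \<comment> \<open>At \<open>u = 0\<close> both sides vanish, also for k = 1, because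
    \<open>0 powr 0 = 0\<close>.\<close>
  have up: "u * u powr (k - 1) = u powr k"
    using u by (cases "u = 0") (auto simp: powr_diff)
  have "(\<Sum>i\<in>I. w i * (k * y i * u powr (k - 1))) \<le>
      (\<Sum>i\<in>I. w i * (y i powr k + (k - 1) * u powr k))"
    using w y u k by (intro sum_mono mult_left_mono powr_tangent_bound) auto
  also have "\<dots> = (\<Sum>i\<in>I. w i * y i powr k) + sum w I * ((k - 1) * u powr k)"
    by (simp add: distrib_left sum.distrib sum_distrib_right)
  also have "(\<Sum>i\<in>I. w i * (k * y i * u powr (k - 1))) = k * u powr (k - 1) * u"
  proof -
    have "(\<Sum>i\<in>I. w i * (k * y i * v)) = k * v * u" for v
      unfolding u_def by (simp add: sum_distrib_left mult_ac)
    then show ?thesis .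
  qed
  also have "\<dots> = k * u powr k" using up by (simp add: mult.commute mult.left_commute)
  finally show ?thesis using w(2) by (simp add: u_def algebra_simps)
qed

lemma powr_sum_le:
  fixes x :: "'i \<Rightarrow> real"
  assumes "k \<ge> 1" "finite I"
  shows "\<bar>\<Sum>i\<in>I. x i\<bar> powr k \<le> real (card I) powr (k - 1) * (\<Sum>i\<in>I. \<bar>x i\<bar> powr k)"
proof (cases "I = {}")
  case False
  define n where "n = real (card I)"
  have n: "n > 0" using False assms by (simp add: n_def card_gt_0_iff)
  have "\<bar>\<Sum>i\<in>I. x i\<bar> powr k \<le> (\<Sum>i\<in>I. \<bar>x i\<bar>) powr k"
    using assms by (intro powr_mono2 sum_abs) auto
  also have "(\<Sum>i\<in>I. \<bar>x i\<bar>) = n * (\<Sum>i\<in>I. 1 / n * \<bar>x i\<bar>)"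
    using n by (simp add: sum_distrib_left)
  also have "\<dots> powr k = n powr k * (\<Sum>i\<in>I. 1 / n * \<bar>x i\<bar>) powr k"
    by (rule powr_mult)
  also have "\<dots> \<le> n powr k * (\<Sum>i\<in>I. 1 / n * \<bar>x i\<bar> powr k)"
    using n assms by (intro mult_left_mono powr_weighted_mean_le) (auto simp: n_def)
  also have "\<dots> = n powr (k - 1) * (\<Sum>i\<in>I. \<bar>x i\<bar> powr k)"
    using n by (simp add: sum_distrib_left powr_diff)
  finally show ?thesis by (simp add: n_def)
qed simp

text \<open>Jensen for u - v = (1 - t) (u / (1 - t)) + t (- v / t). The free weight \<open>t\<close>
  is the point: as t tends to 0 the coefficient of |u|^k tends to 1, so a small \<open>v\<close> can
  be removed asymptotically without loss.\<close>

lemma powr_diff_le: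
  fixes u v t k :: real
  assumes "k \<ge> 1" "0 < t" "t < 1"
  shows "\<bar>u - v\<bar> powr k \<le> (1 - t) powr (1 - k) * \<bar>u\<bar> powr k + t powr (1 - k) * \<bar>v\<bar> powr k"
proof -
  define w where "w b = (if b then t else 1 - t)" for b
  define y where "y b = (if b then \<bar>v\<bar> / t else \<bar>u\<bar> / (1 - t))" for b
  have "\<bar>u - v\<bar> powr k \<le> (\<Sum>b\<in>UNIV. w b * y b) powr k"
    using assms by (intro powr_mono2) (auto simp: UNIV_bool w_def y_def)
  also have "\<dots> \<le> (\<Sum>b\<in>UNIV. w b * y b powr k)"
    using assms by (intro powr_weighted_mean_le) (auto simp: UNIV_bool w_def y_def)
  also have "\<dots> = (1 - t) powr (1 - k) * \<bar>u\<bar> powr k + t powr (1 - k) * \<bar>v\<bar> powr k"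
    using assms by (simp add: UNIV_bool w_def y_def powr_divide powr_diff)
  finally show ?thesis .
qed

lemma (in prob_space) expectation_powr_le:
  fixes f :: "'a \<Rightarrow> real"
  assumes k: "k \<ge> 1" and f: "integrable M f" "\<And>x. f x \<ge> 0" "integrable M (\<lambda>x. f x powr k)"
  shows "expectation f powr k \<le> expectation (\<lambda>x. f x powr k)"
proof -
  define u where "u = expectation f"
  have u: "u \<ge> 0" unfolding u_def using f by simp
  have up: "u * u powr (k - 1) = u powr k"
    using u by (cases "u = 0") (auto simp: powr_diff)
  have "expectation (\<lambda>x. k * f x * u powr (k - 1)) \<le> expectation (\<lambda>x. f x powr k + (k - 1) * u powr k)"
    using f u k by (intro integral_mono powr_tangent_bound integrable_mult_left integrable_mult_right
        Bochner_Integration.integrable_add) auto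
  also have "\<dots> = expectation (\<lambda>x. f x powr k) + (k - 1) * u powr k"
    using f by (simp add: prob_space)
  also have "expectation (\<lambda>x. k * f x * u powr (k - 1)) = k * u powr k"
    using up by (simp add: u_def mult.assoc)
  finally show ?thesis by (simp add: u_def algebra_simps)
qed

section \<open>Derivatives of powers of |x| and the second-order Taylor inequality\<close>

lemma eventually_sgn_eq:
  fixes x :: real
  assumes "x \<noteq> 0"
  shows "\<forall>\<^sub>F y in nhds x. sgn y = sgn x"
proof (cases "x > 0")
  case True
  have "\<forall>\<^sub>F y in nhds x. y > 0"
    using eventually_nhds_in_open[of "{0<..}" x] True by simp
  then show ?thesis by (rule eventually_mono) (use True in auto)
next
  case False
  have "\<forall>\<^sub>F y in nhds x. y < 0"
    using eventually_nhds_in_open[of "{..<0}" x] False assms by simp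
  then show ?thesis by (rule eventually_mono) (use False assms in auto)
qed

text \<open>Away from 0, |y| may be replaced locally by \<open>sgn x * y\<close>. At 0 the
  difference quotient is \<open>sgn h * \<bar>h\<bar> powr (p - 1)\<close>, which tends to 0 because
  p > 1.\<close>

lemma DERIV_abs_powr:
  fixes x p :: real
  assumes p: "p > 1"
  shows "((\<lambda>x. \<bar>x\<bar> powr p) has_real_derivative p * sgn x * \<bar>x\<bar> powr (p - 1)) (at x)"
proof (cases "x = 0")
  case False
  have "((\<lambda>y. (sgn x * y) powr p) has_real_derivative p * (sgn x * x) powr (p - 1) * sgn x) (at x)"
    using False by (auto intro!: derivative_eq_intros simp: sgn_mult_self_eq zero_less_mult_iff sgn_if)
  moreover have "\<forall>\<^sub>F y in nhds x. (sgn x * y) powr p = \<bar>y\<bar> powr p"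
    using eventually_sgn_eq[OF False] by eventually_elim (metis abs_sgn mult.commute)
  ultimately have "((\<lambda>y. \<bar>y\<bar> powr p) has_real_derivative p * (sgn x * x) powr (p - 1) * sgn x) (at x)"
    by (subst (asm) DERIV_cong_ev[OF refl _ refl])
  then show ?thesis by (simp add: abs_sgn mult_ac)
next
  case True
  have "((\<lambda>h. \<bar>h\<bar> powr (p - 1)) \<longlongrightarrow> \<bar>0\<bar> powr (p - 1)) (at (0::real))"
    using p by (intro tendsto_powr' tendsto_rabs tendsto_ident_at tendsto_const) auto
  moreover have "\<forall>\<^sub>F h in at (0::real). \<bar>h\<bar> powr (p - 1) = \<bar>sgn h * \<bar>h\<bar> powr (p - 1)\<bar>"
    by (auto simp: eventually_at_filter abs_mult abs_sgn_eq)
  ultimately have "((\<lambda>h. \<bar>sgn h * \<bar>h\<bar> powr (p - 1)\<bar>) \<longlongrightarrow> 0) (at (0::real))"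
    using Lim_transform_eventually by fastforce
  then have *: "((\<lambda>h. sgn h * \<bar>h\<bar> powr (p - 1)) \<longlongrightarrow> 0) (at (0::real))"
    by (rule tendsto_rabs_zero_cancel)
  have "((\<lambda>h. (\<bar>0 + h\<bar> powr p - \<bar>0\<bar> powr p) / h) \<longlongrightarrow> 0) (at (0::real))"
    by (rule Lim_transform_eventually[OF *])
       (auto simp: eventually_at_filter sgn_if powr_diff divide_simps)
  then show ?thesis using True by (simp add: DERIV_def)
qed

text \<open>Complements \<open>DERIV_abs_powr\<close>: together they differentiate |x|^(2+d) twice,
  also at 0, since the exponent 1 + d of the first derivative still exceeds 1.\<close>

lemma DERIV_sgn_abs_powr:
  fixes x p :: real
  assumes p: "p > 1"
  shows "((\<lambda>x. sgn x * \<bar>x\<bar> powr p) has_real_derivative p * \<bar>x\<bar> powr (p - 1)) (at x)"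
proof (cases "x = 0")
  case False
  have "((\<lambda>y. sgn x * \<bar>y\<bar> powr p) has_real_derivative sgn x * (p * sgn x * \<bar>x\<bar> powr (p - 1))) (at x)"
    by (rule DERIV_cmult[OF DERIV_abs_powr[OF p]])
  moreover have "\<forall>\<^sub>F y in nhds x. sgn x * \<bar>y\<bar> powr p = sgn y * \<bar>y\<bar> powr p"
    using eventually_sgn_eq[OF False] by eventually_elim simp
  ultimately have "((\<lambda>y. sgn y * \<bar>y\<bar> powr p) has_real_derivative sgn x * (p * sgn x * \<bar>x\<bar> powr (p - 1))) (at x)"
    by (subst (asm) DERIV_cong_ev[OF refl _ refl])
  moreover have "sgn x * (p * sgn x * \<bar>x\<bar> powr (p - 1)) = p * \<bar>x\<bar> powr (p - 1)"
    using False by (simp add: sgn_if)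
  ultimately show ?thesis by simp
next
  case True
  have *: "((\<lambda>h. \<bar>h\<bar> powr (p - 1)) \<longlongrightarrow> \<bar>0\<bar> powr (p - 1)) (at (0::real))"
    using p by (intro tendsto_powr' tendsto_rabs tendsto_ident_at tendsto_const) auto
  have "((\<lambda>h. (sgn (0 + h) * \<bar>0 + h\<bar> powr p - sgn 0 * \<bar>0\<bar> powr p) / h) \<longlongrightarrow> 0) (at (0::real))"
    by (rule Lim_transform_eventually) (use * in
       \<open>auto simp: eventually_at_filter sgn_if powr_diff divide_simps\<close>)
  then show ?thesis using True by (simp add: DERIV_def)
qed

text \<open>A fraction z in [0, 1] satisfies z <= z^d for d <= 1. Applied to x / (x + y) and y / (x
  + y), whose sum is 1, this gives the claim after clearing the denominator.\<close>

lemma powr_add_subadditive: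
  fixes x y d :: real
  assumes "0 \<le> d" "d \<le> 1" "x \<ge> 0" "y \<ge> 0"
  shows "(x + y) powr d \<le> x powr d + y powr d"
proof (cases "x + y = 0")
  case False
  then have s: "x + y > 0" using assms by linarith
  have *: "z / (x + y) \<le> (z / (x + y)) powr d" if "0 \<le> z" "z \<le> x + y" for z
    using powr_mono'[of d 1 "z / (x + y)"] that s assms by auto
  have "1 = x / (x + y) + y / (x + y)" using s by (simp flip: add_divide_distrib)
  also have "\<dots> \<le> (x / (x + y)) powr d + (y / (x + y)) powr d"
    using assms by (intro add_mono *) auto
  also have "\<dots> = (x powr d + y powr d) / (x + y) powr d"
    using assms s by (simp add: powr_divide add_divide_distrib)
  finally show ?thesis using s by (simp add: field_simps)
qed (use assms in auto)

lemma abs_powr_taylor_le: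
  fixes s x d :: real
  assumes d: "0 < d" "d \<le> 1"
  shows "\<bar>s + x\<bar> powr (2 + d) \<le> \<bar>s\<bar> powr (2 + d) + (2 + d) * sgn s * \<bar>s\<bar> powr (1 + d) * x
            + (2 + d) * (1 + d) / 2 * \<bar>s\<bar> powr d * x\<^sup>2 + \<bar>x\<bar> powr (2 + d)"
proof -
  (* h and h1 = h' vanish at 0, and h'' = h2 is non-negative since t powr d is subadditive. *)
  define h where "h x = \<bar>s\<bar> powr (2 + d) + (2 + d) * sgn s * \<bar>s\<bar> powr (1 + d) * x
            + (2 + d) * (1 + d) / 2 * \<bar>s\<bar> powr d * x\<^sup>2 + \<bar>x\<bar> powr (2 + d) - \<bar>s + x\<bar> powr (2 + d)" for x
  define h1 where "h1 x = (2 + d) * (sgn s * \<bar>s\<bar> powr (1 + d) + (1 + d) * \<bar>s\<bar> powr d * x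
            + sgn x * \<bar>x\<bar> powr (1 + d) - sgn (s + x) * \<bar>s + x\<bar> powr (1 + d))" for x
  define h2 where "h2 x = (2 + d) * (1 + d) * (\<bar>s\<bar> powr d + \<bar>x\<bar> powr d - \<bar>s + x\<bar> powr d)" for x
  have Q: "((\<lambda>x. u + v * x + w * x\<^sup>2) has_real_derivative v + 2 * w * x) (at x)" for u v w x :: real
    by (auto intro!: derivative_eq_intros)
  have Q': "((\<lambda>x. u + v * x) has_real_derivative v) (at x)" for u v x :: real
    by (auto intro!: derivative_eq_intros)
  have P: "((\<lambda>x. \<bar>x\<bar> powr (2 + d)) has_real_derivative (2 + d) * sgn x * \<bar>x\<bar> powr (2 + d - 1)) (at x)"
    "((\<lambda>x. sgn x * \<bar>x\<bar> powr (1 + d)) has_real_derivative (1 + d) * \<bar>x\<bar> powr (1 + d - 1)) (at x)" for x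
    using d by (intro DERIV_abs_powr DERIV_sgn_abs_powr; simp)+
  have D1: "(h has_real_derivative h1 x) (at x)" for x
  proof -
    have D: "((\<lambda>x. \<bar>s + x\<bar> powr (2 + d)) has_real_derivative
             (2 + d) * sgn (s + x) * \<bar>s + x\<bar> powr (2 + d - 1) * 1) (at x)"
      using d by (intro DERIV_chain2[OF DERIV_abs_powr]) (auto intro!: derivative_eq_intros)
    show ?thesis
      unfolding h_def
      by (rule DERIV_cong[OF DERIV_diff[OF DERIV_add[OF Q[of _ _ "(2 + d) * (1 + d) / 2 * \<bar>s\<bar> powr d"] P(1)] D]])
        (simp add: h1_def algebra_simps)
  qed
  have D2: "(h1 has_real_derivative h2 x) (at x)" for x
  proof -
    have D: "((\<lambda>x. sgn (s + x) * \<bar>s + x\<bar> powr (1 + d)) has_real_derivative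
             (1 + d) * \<bar>s + x\<bar> powr (1 + d - 1) * 1) (at x)"
      using d by (intro DERIV_chain2[OF DERIV_sgn_abs_powr]) (auto intro!: derivative_eq_intros)
    show ?thesis
      unfolding h1_def
      by (rule DERIV_cong[OF DERIV_cmult[OF DERIV_diff[OF DERIV_add[OF Q' P(2)] D]]])
        (simp add: h2_def algebra_simps)
  qed
  have h2: "h2 x \<ge> 0" for x
  proof -
    have "\<bar>s + x\<bar> powr d \<le> (\<bar>s\<bar> + \<bar>x\<bar>) powr d" using d by (intro powr_mono2) auto
    also have "\<dots> \<le> \<bar>s\<bar> powr d + \<bar>x\<bar> powr d" using d by (intro powr_add_subadditive) auto
    finally show ?thesis unfolding h2_def using d by simp
  qed
  \<comment> \<open>Since \<open>h1\<close> is nondecreasing and \<open>h1 0 = 0\<close>,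
    \<open>h\<close> decreases left of 0 and increases right of it, so its minimum is
    \<open>h 0 = 0\<close>.\<close>
  have mono: "h1 a \<le> h1 b" if "a \<le> b" for a b
    using that D2 h2 DERIV_nonneg_imp_nondecreasing by blast
  have h10: "h1 0 = 0" and h0: "h 0 = 0" by (simp_all add: h1_def h_def)
  have "h x \<ge> 0"
  proof (cases "x \<ge> 0")
    case True
    have "h 0 \<le> h x"
      by (rule DERIV_nonneg_imp_nondecreasing[OF True]) (metis D1 mono h10)
    then show ?thesis using h0 by simp
  next
    case False
    have "h 0 \<le> h x"
      by (rule DERIV_nonpos_imp_nonincreasing[of x 0]) (use False in simp, metis D1 mono h10)
    then show ?thesis using h0 by simp
  qed
  then show ?thesis by (simp add: h_def)
qed

section \<open>Random sums and their moments\<close>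

lemma indep_vars_PiM_components:
  assumes "I \<noteq> {}" "\<And>i. i \<in> I \<Longrightarrow> prob_space (M i)"
  shows "prob_space.indep_vars (PiM I M) M (\<lambda>i x. x i) I"
proof -
  interpret prob_space "PiM I M" by (intro prob_space_PiM assms)
  have "distr (PiM I M) (PiM I M) (\<lambda>x. \<lambda>i\<in>I. x i) = distr (PiM I M) (PiM I M) (\<lambda>x. x)"
    by (intro distr_cong) (auto simp: space_PiM)
  also have "\<dots> = (\<Pi>\<^sub>M i\<in>I. distr (PiM I M) (M i) (\<lambda>x. x i))"
    by (auto simp: distr_PiM_component assms intro!: PiM_cong)
  finally show ?thesis
    using assms by (subst indep_vars_iff_distr_eq_PiM') auto
qed

text \<open>The summand type is left general because both real summands and natural ones (for N =
  {N_lam, Y}) occur. On \<open>nat\<close> the topology is discrete, so \<open>borel\<close> there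
  has the same sets as \<open>count_space UNIV\<close>.\<close>

locale random_sum =
  fixes \<nu> :: "nat measure" and \<mu> :: "'b::{second_countable_topology, topological_comm_monoid_add} measure"
  assumes prob_nu: "prob_space \<nu>" and sets_nu[measurable_cong]: "sets \<nu> = sets (count_space UNIV)"
    and prob_mu: "prob_space \<mu>" and sets_mu[measurable_cong]: "sets \<mu> = sets borel"
begin

sublocale nu: prob_space \<nu> by (fact prob_nu)
sublocale mu: prob_space \<mu> by (fact prob_mu)

abbreviation "PX \<equiv> \<Pi>\<^sub>M i\<in>(UNIV::nat set). \<mu>"
abbreviation "R \<equiv> random_sum_law \<nu> \<mu>"

sublocale PX: prob_space PX by (intro prob_space_PiM mu.prob_space_axioms)
sublocale pair_prob_space \<nu> PX ..

lemma space_nu [simp]: "space \<nu> = UNIV" using sets_eq_imp_space_eq[OF sets_nu] by simp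
lemma space_mu [simp]: "space \<mu> = UNIV" using sets_eq_imp_space_eq[OF sets_mu] by simp

lemma indep_PX: "PX.indep_vars (\<lambda>_. borel) (\<lambda>i x. x i) A"
proof -
  have "PX.indep_vars (\<lambda>_. \<mu>) (\<lambda>i x. x i) UNIV"
    by (intro indep_vars_PiM_components prob_mu) simp
  then have "PX.indep_vars (\<lambda>_. \<mu>) (\<lambda>i x. x i) A" 
    by (rule PX.indep_vars_subset) auto
  then show ?thesis
    using PX.indep_vars_compose2[where M'="\<lambda>_. \<mu>" and Y="\<lambda>_ x. x" and N="\<lambda>_. borel"] by simp
qed

lemma measurable_sum_PX [measurable]: "(\<lambda>x. \<Sum>i = 1..n. x i) \<in> borel_measurable PX" for n :: nat
  by measurable

lemma measurable_random_sum [measurable]: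
  "(\<lambda>(n, x). \<Sum>i = 1..n. x i) \<in> borel_measurable (\<nu> \<Otimes>\<^sub>M PX)"
proof -
  have "(\<lambda>(n, x). \<Sum>i = 1..n. x i) \<in> borel_measurable (count_space (UNIV :: nat set) \<Otimes>\<^sub>M PX)"
    by (rule measurable_pair_measure_countable1) (auto simp: measurable_sum_PX)
  also have "\<dots> = borel_measurable (\<nu> \<Otimes>\<^sub>M PX)"
    by (intro measurable_cong_sets sets_pair_measure_cong) (auto simp: sets_nu)
  finally show ?thesis .
qed

lemma sets_R [simp, measurable_cong]: "sets R = sets borel"
  by (simp add: random_sum_law_def sets_mu)

lemma R_eq: "R = distr (\<nu> \<Otimes>\<^sub>M PX) borel (\<lambda>(n, x). \<Sum>i = 1..n. x i)"
  unfolding random_sum_law_def by (intro distr_cong) (auto simp: sets_mu)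

lemma prob_R: "prob_space R"
  unfolding R_eq by (intro prob_space_distr measurable_random_sum)

lemma nn_integral_R:
  assumes [measurable]: "g \<in> borel_measurable borel"
  shows "(\<integral>\<^sup>+ v. g v \<partial>R) = (\<integral>\<^sup>+ n. \<integral>\<^sup>+ x. g (\<Sum>i = 1..n. x i) \<partial>PX \<partial>\<nu>)"
  unfolding R_eq
  by (simp add: nn_integral_distr PX.nn_integral_fst[symmetric] case_prod_unfold)

lemma integral_R:
  fixes g :: "'b \<Rightarrow> 'c::{banach, second_countable_topology}"
  assumes g: "integrable R g"
  shows "(\<integral> v. g v \<partial>R) = (\<integral> n. \<integral> x. g (\<Sum>i = 1..n. x i) \<partial>PX \<partial>\<nu>)"
proof -
  have [measurable]: "g \<in> borel_measurable borel"
    using borel_measurable_integrable[OF g] by measurable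
  have "integrable (\<nu> \<Otimes>\<^sub>M PX) (\<lambda>(n, x). g (\<Sum>i = 1..n. x i))"
    using g unfolding R_eq by (subst (asm) integrable_distr_eq) (auto simp: case_prod_unfold)
  from integral_fst'[OF this] show ?thesis
    unfolding R_eq by (subst integral_distr) (auto simp: case_prod_unfold)
qed

lemma integral_component:
  fixes g :: "'b \<Rightarrow> 'c::{banach, second_countable_topology}"
  assumes [measurable]: "g \<in> borel_measurable borel"
  shows "(\<integral> x. g (x i) \<partial>PX) = (\<integral> x. g x \<partial>\<mu>)"
    "integrable PX (\<lambda>x. g (x i)) \<longleftrightarrow> integrable \<mu> g"
proof -
  have *: "\<mu> = distr PX borel (\<lambda>x. x i)"
    using distr_PiM_component[of UNIV "\<lambda>_. \<mu>" i] prob_mu sets_mu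
    by (metis UNIV_I distr_cong)
  show "(\<integral> x. g (x i) \<partial>PX) = (\<integral> x. g x \<partial>\<mu>)"
    by (subst (2) *) (simp add: integral_distr)
  show "integrable PX (\<lambda>x. g (x i)) \<longleftrightarrow> integrable \<mu> g"
    by (subst (2) *) (simp add: integrable_distr_eq)
qed

lemma has_bochner_integral_component:
  fixes g :: "'b \<Rightarrow> 'c::{banach, second_countable_topology}"
  assumes [measurable]: "g \<in> borel_measurable borel" and "has_bochner_integral \<mu> g c"
  shows "has_bochner_integral PX (\<lambda>x. g (x i)) c"
  using assms(2) integral_component[OF assms(1), of i] by (simp add: has_bochner_integral_iff)

text \<open>Serves two purposes: with the exponential e^(itx) it gives the characteristic function
  of a random sum, and with z^k on the natural numbers it composes generating functions, as
  associativity requires.\<close>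

lemma integral_multiplicative:
  fixes g :: "'b \<Rightarrow> complex"
  assumes [measurable]: "g \<in> borel_measurable borel"
    and g: "\<And>x. norm (g x) \<le> 1" "g 0 = 1" "\<And>x y. g (x + y) = g x * g y"
  shows "(\<integral> v. g v \<partial>R) = (\<integral> n. (\<integral> x. g x \<partial>\<mu>) ^ n \<partial>\<nu>)"
proof -
  interpret R: prob_space R by (rule prob_R)
  have "integrable R g"
    using g(1) by (intro R.integrable_const_bound[where B=1]) auto
  then have "(\<integral> v. g v \<partial>R) = (\<integral> n. \<integral> x. g (\<Sum>i = 1..n. x i) \<partial>PX \<partial>\<nu>)"
    by (rule integral_R)
  also have "(\<lambda>n. \<integral> x. g (\<Sum>i = 1..n. x i) \<partial>PX) = (\<lambda>n. (\<integral> x. g x \<partial>\<mu>) ^ n)"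
  proof
    fix n
    have "g (\<Sum>i\<in>A. x i) = (\<Prod>i\<in>A. g (x i))" for A :: "nat set" and x
      by (induction A rule: infinite_finite_induct) (auto simp: g)
    then have "(\<integral> x. g (\<Sum>i = 1..n. x i) \<partial>PX) = (\<integral> x. (\<Prod>i = 1..n. g (x i)) \<partial>PX)" by simp
    also have "\<dots> = (\<Prod>i = 1..n. \<integral> x. g (x i) \<partial>PX)"
    proof (rule PX.indep_vars_lebesgue_integral)
      show "PX.indep_vars (\<lambda>_. borel) (\<lambda>i x. g (x i)) {1..n}"
        by (rule PX.indep_vars_compose2[OF indep_PX]) simp
      show "integrable PX (\<lambda>x. g (x i))" for i
        using g(1) by (intro PX.integrable_const_bound[where B=1]) auto
    qed simp
    also have "\<dots> = (\<integral> x. g x \<partial>\<mu>) ^ n" by (simp add: integral_component)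
    finally show "(\<integral> x. g (\<Sum>i = 1..n. x i) \<partial>PX) = (\<integral> x. g x \<partial>\<mu>) ^ n" .
  qed
  finally show ?thesis .
qed

end

(* Otherwise simp rewrites {1..n} to {Suc 0..n}. *)
declare One_nat_def [simp del]

section \<open>Moments of real random sums, without and with centring\<close>

lemma (in prob_space) integrable_abs_powr_le:
  fixes f :: "'a \<Rightarrow> real"
  assumes [measurable]: "f \<in> borel_measurable M"
    and f: "integrable M (\<lambda>x. \<bar>f x\<bar> powr p)" and q: "0 \<le> q" "q \<le> p"
  shows "integrable M (\<lambda>x. \<bar>f x\<bar> powr q)"
proof (rule Bochner_Integration.integrable_bound)
  show "integrable M (\<lambda>x. 1 + \<bar>f x\<bar> powr p)" using f by simp
  have "y powr q \<le> 1 + y powr p" if "y \<ge> 0" for y :: real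
  proof (cases "y \<le> 1")
    case True
    then have "y powr q \<le> 1" using that q powr_mono2[of q y 1] by simp
    then show ?thesis by (simp add: add_increasing2)
  next
    case False
    then have "y powr q \<le> y powr p" using q by (intro powr_mono) auto
    then show ?thesis by simp
  qed
  then show "AE x in M. norm (\<bar>f x\<bar> powr q) \<le> norm (1 + \<bar>f x\<bar> powr p)" by (auto simp: add_nonneg_nonneg)
qed measurable

lemma (in prob_space) integrable_powr_imp:
  fixes f :: "'a \<Rightarrow> real"
  assumes [measurable]: "f \<in> borel_measurable M" and f: "integrable M (\<lambda>x. \<bar>f x\<bar> powr p)" and p: "p \<ge> 2"
  shows "integrable M f" "integrable M (\<lambda>x. (f x)\<^sup>2)"
proof -
  have "integrable M (\<lambda>x. \<bar>f x\<bar> powr 1)" by (rule integrable_abs_powr_le[OF _ f]) (use p in auto)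
  then have "integrable M (\<lambda>x. \<bar>f x\<bar>)" by simp
  then show "integrable M f" by (rule integrable_abs_cancel) simp
  have "integrable M (\<lambda>x. \<bar>f x\<bar> powr 2)" by (rule integrable_abs_powr_le[OF _ f]) (use p in auto)
  then show "integrable M (\<lambda>x. (f x)\<^sup>2)" by simp
qed

locale real_random_sum = random_sum \<nu> \<mu> for \<nu> :: "nat measure" and \<mu> :: "real measure"
begin

text \<open>Turns a bound conditional on N = n into one for the random sum. Working with
  \<open>nn_integral\<close> makes Tonelli applicable before integrability is known, so that
  integrability and the estimate come out together.\<close>

lemma R_integrable_bound:
  fixes g :: "real \<Rightarrow> real" and f :: "nat \<Rightarrow> real"
  assumes [measurable]: "g \<in> borel_measurable borel"
    and g: "\<And>n. integrable PX (\<lambda>x. g (\<Sum>i = 1..n. x i))"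
    and le: "\<And>n. (\<integral> x. \<bar>g (\<Sum>i = 1..n. x i)\<bar> \<partial>PX) \<le> f n"
    and f: "integrable \<nu> f"
  shows "integrable R g" "(\<integral> v. \<bar>g v\<bar> \<partial>R) \<le> (\<integral> n. f n \<partial>\<nu>)"
proof -
  have f0: "f n \<ge> 0" for n using le[of n] by (rule order_trans[rotated]) simp
  have "(\<integral>\<^sup>+ v. ennreal \<bar>g v\<bar> \<partial>R) = (\<integral>\<^sup>+ n. \<integral>\<^sup>+ x. ennreal \<bar>g (\<Sum>i = 1..n. x i)\<bar> \<partial>PX \<partial>\<nu>)"
    by (rule nn_integral_R) simp
  also have "\<dots> = (\<integral>\<^sup>+ n. ennreal (\<integral> x. \<bar>g (\<Sum>i = 1..n. x i)\<bar> \<partial>PX) \<partial>\<nu>)"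
    using g by (intro nn_integral_cong nn_integral_eq_integral) auto
  also have "\<dots> \<le> (\<integral>\<^sup>+ n. ennreal (f n) \<partial>\<nu>)"
    using le by (intro nn_integral_mono ennreal_leI)
  also have "\<dots> = ennreal (\<integral> n. f n \<partial>\<nu>)"
    using f f0 by (intro nn_integral_eq_integral) auto
  finally have *: "(\<integral>\<^sup>+ v. ennreal \<bar>g v\<bar> \<partial>R) \<le> ennreal (\<integral> n. f n \<partial>\<nu>)" .
  then have "(\<integral>\<^sup>+ v. ennreal (norm (g v)) \<partial>R) < \<infinity>"
    by (auto simp: less_top[symmetric] top_unique)
  then show i: "integrable R g" by (intro integrableI_bounded) auto
  have "ennreal (\<integral> v. \<bar>g v\<bar> \<partial>R) \<le> ennreal (\<integral> n. f n \<partial>\<nu>)"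
    using * i by (subst (asm) nn_integral_eq_integral) auto
  then show "(\<integral> v. \<bar>g v\<bar> \<partial>R) \<le> (\<integral> n. f n \<partial>\<nu>)"
    using f0 by (subst (asm) ennreal_le_iff) (auto intro!: integral_nonneg_AE)
qed

lemma abs_moment_sum:
  assumes k: "k \<ge> 1" and x: "integrable \<mu> (\<lambda>x. \<bar>x\<bar> powr k)"
  shows "integrable PX (\<lambda>x. \<bar>\<Sum>i = 1..n. x i\<bar> powr k)"
    "(\<integral> x. \<bar>\<Sum>i = 1..n. x i\<bar> powr k \<partial>PX) \<le> real n powr k * (\<integral> x. \<bar>x\<bar> powr k \<partial>\<mu>)"
proof -
  have xi: "integrable PX (\<lambda>x. \<bar>x i\<bar> powr k)" for i
    using x integral_component(2)[of "\<lambda>x. \<bar>x\<bar> powr k" i] by simp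
  have le: "\<bar>\<Sum>i = 1..n. x i\<bar> powr k \<le> real n powr (k - 1) * (\<Sum>i = 1..n. \<bar>x i\<bar> powr k)" for x :: "nat \<Rightarrow> real"
    using powr_sum_le[OF k, of "{1..n}" x] by simp
  have i: "integrable PX (\<lambda>x. real n powr (k - 1) * (\<Sum>i = 1..n. \<bar>x i\<bar> powr k))"
    using xi by (intro integrable_mult_right Bochner_Integration.integrable_sum)
  show i': "integrable PX (\<lambda>x. \<bar>\<Sum>i = 1..n. x i\<bar> powr k)"
    by (rule Bochner_Integration.integrable_bound[OF i])
       (use le in \<open>auto simp: abs_mult sum_nonneg intro!: AE_I2\<close>)
  have "(\<integral> x. \<bar>\<Sum>i = 1..n. x i\<bar> powr k \<partial>PX) \<le> (\<integral> x. real n powr (k - 1) * (\<Sum>i = 1..n. \<bar>x i\<bar> powr k) \<partial>PX)"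
    using le by (intro integral_mono i i')
  also have "\<dots> = real n powr (k - 1) * (\<Sum>i = 1..n. \<integral> x. \<bar>x i\<bar> powr k \<partial>PX)"
    using xi by (simp add: Bochner_Integration.integral_sum)
  also have "\<dots> = real n powr (k - 1) * n * (\<integral> x. \<bar>x\<bar> powr k \<partial>\<mu>)"
    using integral_component(1)[of "\<lambda>x. \<bar>x\<bar> powr k"] by simp
  also have "real n powr (k - 1) * n = real n powr k"
    using k by (cases "n = 0") (auto simp: powr_diff)
  finally show "(\<integral> x. \<bar>\<Sum>i = 1..n. x i\<bar> powr k \<partial>PX) \<le> real n powr k * (\<integral> x. \<bar>x\<bar> powr k \<partial>\<mu>)" .
qed

lemma abs_moment_R:
  assumes k: "k \<ge> 1" and x: "integrable \<mu> (\<lambda>x. \<bar>x\<bar> powr k)" and n: "integrable \<nu> (\<lambda>n. real n powr k)"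
  shows "integrable R (\<lambda>v. \<bar>v\<bar> powr k)"
    "(\<integral> v. \<bar>v\<bar> powr k \<partial>R) \<le> (\<integral> n. real n powr k \<partial>\<nu>) * (\<integral> x. \<bar>x\<bar> powr k \<partial>\<mu>)"
proof -
  note * = R_integrable_bound[of "\<lambda>v. \<bar>v\<bar> powr k" "\<lambda>n. real n powr k * (\<integral> x. \<bar>x\<bar> powr k \<partial>\<mu>)",
      OF _ abs_moment_sum(1)[OF k x]]
  show "integrable R (\<lambda>v. \<bar>v\<bar> powr k)"
    by (rule *(1)) (simp_all add: abs_moment_sum(2)[OF k x] n)
  have "(\<integral> v. \<bar>\<bar>v\<bar> powr k\<bar> \<partial>R) \<le> (\<integral> n. real n powr k * (\<integral> x. \<bar>x\<bar> powr k \<partial>\<mu>) \<partial>\<nu>)"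
    by (rule *(2)) (simp_all add: abs_moment_sum(2)[OF k x] n)
  then show "(\<integral> v. \<bar>v\<bar> powr k \<partial>R) \<le> (\<integral> n. real n powr k \<partial>\<nu>) * (\<integral> x. \<bar>x\<bar> powr k \<partial>\<mu>)"
    by simp
qed

lemma indep_Suc:
  "PX.indep_var borel (\<lambda>x. x (Suc n)) borel (\<lambda>x. \<Sum>i = 1..n. x i)" for n :: nat
  by (rule PX.indep_vars_sum[OF _ _ indep_PX]) simp_all

lemma moments_sum:
  assumes x: "integrable \<mu> (\<lambda>x. x\<^sup>2)"
  defines "m \<equiv> \<integral> x. x \<partial>\<mu>"
  shows "integrable PX (\<lambda>x. \<Sum>i = 1..n. x i)" "integrable PX (\<lambda>x. (\<Sum>i = 1..n. x i)\<^sup>2)"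
    "(\<integral> x. (\<Sum>i = 1..n. x i) \<partial>PX) = real n * m"
    "(\<integral> x. (\<Sum>i = 1..n. x i)\<^sup>2 \<partial>PX) = real n * ((\<integral> x. x\<^sup>2 \<partial>\<mu>) - m\<^sup>2) + (real n)\<^sup>2 * m\<^sup>2"
proof -
  have x1: "integrable \<mu> (\<lambda>x. x)"
    using mu.integrable_powr_imp[of "\<lambda>x. x" 2] x by simp
  have xi: "integrable PX (\<lambda>x. x i)" "integrable PX (\<lambda>x. (x i)\<^sup>2)"
      "(\<integral> x. x i \<partial>PX) = m" "(\<integral> x. (x i)\<^sup>2 \<partial>PX) = (\<integral> x. x\<^sup>2 \<partial>\<mu>)" for i
  proof -
    have "has_bochner_integral PX (\<lambda>x. x i) (\<integral> x. x \<partial>\<mu>)"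
      by (rule has_bochner_integral_component[OF _ has_bochner_integral_integrable[OF x1]]) simp
    moreover have "has_bochner_integral PX (\<lambda>x. (x i)\<^sup>2) (\<integral> x. x\<^sup>2 \<partial>\<mu>)"
      by (rule has_bochner_integral_component[OF _ has_bochner_integral_integrable[OF x]]) simp
    ultimately show "integrable PX (\<lambda>x. x i)" "integrable PX (\<lambda>x. (x i)\<^sup>2)"
      "(\<integral> x. x i \<partial>PX) = m" "(\<integral> x. (x i)\<^sup>2 \<partial>PX) = (\<integral> x. x\<^sup>2 \<partial>\<mu>)"
      unfolding m_def has_bochner_integral_iff by blast+
  qed
  show s: "integrable PX (\<lambda>x. \<Sum>i = 1..n. x i)" for n :: nat
    using xi by (intro Bochner_Integration.integrable_sum)
  show es: "(\<integral> x. (\<Sum>i = 1..n. x i) \<partial>PX) = real n * m" for n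
    using xi by (simp add: Bochner_Integration.integral_sum)
  have "integrable PX (\<lambda>x. (\<Sum>i = 1..n. x i)\<^sup>2) \<and> 
    (\<integral> x. (\<Sum>i = 1..n. x i)\<^sup>2 \<partial>PX) = real n * ((\<integral> x. x\<^sup>2 \<partial>\<mu>) - m\<^sup>2) + (real n)\<^sup>2 * m\<^sup>2"
  proof (induction n)
    case (Suc n)
    define T where "T = (\<lambda>x :: nat \<Rightarrow> real. \<Sum>i = 1..n. x i)"
    have *: "(\<Sum>i = 1..Suc n. x i)\<^sup>2 = (T x)\<^sup>2 + 2 * (x (Suc n) * T x) + (x (Suc n))\<^sup>2" for x
      by (simp add: T_def power2_eq_square algebra_simps)
    have i: "integrable PX (\<lambda>x. x (Suc n) * T x)"
      unfolding T_def by (intro PX.indep_var_integrable indep_Suc s xi)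
    have e: "(\<integral> x. x (Suc n) * T x \<partial>PX) = m * (real n * m)"
      unfolding T_def by (subst PX.indep_var_lebesgue_integral[OF indep_Suc _ s]) (auto simp: xi es)
    show ?case
    proof
      have T2: "integrable PX (\<lambda>x. (T x)\<^sup>2)" using Suc by (simp add: T_def)
      show "integrable PX (\<lambda>x. (\<Sum>i = 1..Suc n. x i)\<^sup>2)"
        unfolding * by (intro Bochner_Integration.integrable_add integrable_mult_right T2 i xi)
      have "(\<integral> x. (\<Sum>i = 1..Suc n. x i)\<^sup>2 \<partial>PX) = (\<integral> x. (T x)\<^sup>2 \<partial>PX) + 2 * (m * (real n * m)) + (\<integral> x. x\<^sup>2 \<partial>\<mu>)"
        unfolding * using T2 i xi e by simp
      also have "(\<integral> x. (T x)\<^sup>2 \<partial>PX) = real n * ((\<integral> x. x\<^sup>2 \<partial>\<mu>) - m\<^sup>2) + (real n)\<^sup>2 * m\<^sup>2"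
        using Suc by (simp add: T_def)
      finally show "(\<integral> x. (\<Sum>i = 1..Suc n. x i)\<^sup>2 \<partial>PX) =
          real (Suc n) * ((\<integral> x. x\<^sup>2 \<partial>\<mu>) - m\<^sup>2) + (real (Suc n))\<^sup>2 * m\<^sup>2"
        by (simp add: power2_eq_square algebra_simps)
    qed
  qed simp
  then show "integrable PX (\<lambda>x. (\<Sum>i = 1..n. x i)\<^sup>2)"
    "(\<integral> x. (\<Sum>i = 1..n. x i)\<^sup>2 \<partial>PX) = real n * ((\<integral> x. x\<^sup>2 \<partial>\<mu>) - m\<^sup>2) + (real n)\<^sup>2 * m\<^sup>2"
    by auto
qed

lemma moments_R:
  assumes x: "integrable \<mu> (\<lambda>x. x\<^sup>2)" and n: "integrable \<nu> (\<lambda>n. (real n)\<^sup>2)"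
  defines "m \<equiv> \<integral> x. x \<partial>\<mu>"
  shows "integrable R (\<lambda>v. v)" "integrable R (\<lambda>v. v\<^sup>2)"
    "(\<integral> v. v \<partial>R) = (\<integral> n. real n \<partial>\<nu>) * m"
    "(\<integral> v. v\<^sup>2 \<partial>R) = (\<integral> n. real n \<partial>\<nu>) * ((\<integral> x. x\<^sup>2 \<partial>\<mu>) - m\<^sup>2) + (\<integral> n. (real n)\<^sup>2 \<partial>\<nu>) * m\<^sup>2"
proof -
  interpret R: prob_space R by (rule prob_R)
  have n1: "integrable \<nu> real"
    using nu.integrable_powr_imp[of "\<lambda>x. real x" 2] n by simp
  have i: "integrable R (\<lambda>v. \<bar>v\<bar> powr 2)"
    using abs_moment_R[of 2] x n by simp
  show i1: "integrable R (\<lambda>v. v)" and i2: "integrable R (\<lambda>v. v\<^sup>2)"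
    using R.integrable_powr_imp[OF _ i] by simp_all
  show "(\<integral> v. v \<partial>R) = (\<integral> n. real n \<partial>\<nu>) * m"
    using n1 by (subst integral_R[OF i1]) (simp add: moments_sum[OF x] m_def)
  show "(\<integral> v. v\<^sup>2 \<partial>R) = (\<integral> n. real n \<partial>\<nu>) * ((\<integral> x. x\<^sup>2 \<partial>\<mu>) - m\<^sup>2) + (\<integral> n. (real n)\<^sup>2 \<partial>\<nu>) * m\<^sup>2"
    using n1 n by (subst integral_R[OF i2]) (simp add: moments_sum[OF x] m_def)
qed

text \<open>Expand |T + x|^(2+d) around the partial sum T, with x the next summand. The linear term
  has mean 0 by independence and centring; the quadratic one is c s E|T|^d <= c s (n s)^(d/2), where
  c = (2+d)(1+d)/2 and s is the second moment. So each summand adds at most (c + 1) (n+1)^(d/2) B,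
  the extra 1 coming from the remainder |x|^(2+d). Accumulating these increments gives the order
  n^(1+d/2).\<close>

lemma abs_moment_sum_centered:
  assumes d: "0 < d" "d \<le> 1" and x: "integrable \<mu> (\<lambda>x. \<bar>x\<bar> powr (2 + d))" and m: "(\<integral> x. x \<partial>\<mu>) = 0"
  shows "(\<integral> x. \<bar>\<Sum>i = 1..n. x i\<bar> powr (2 + d) \<partial>PX) \<le>
     ((2 + d) * (1 + d) / 2 + 1) * real n powr (1 + d / 2) * (\<integral> x. \<bar>x\<bar> powr (2 + d) \<partial>\<mu>)"
proof -
  define B where "B = (\<integral> x. \<bar>x\<bar> powr (2 + d) \<partial>\<mu>)"
  define s where "s = (\<integral> x. x\<^sup>2 \<partial>\<mu>)"
  define c where "c = (2 + d) * (1 + d) / 2"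
  have B0: "B \<ge> 0" and s0: "s \<ge> 0" and c0: "c \<ge> 0" using d by (simp_all add: B_def s_def c_def)
  have x1: "integrable \<mu> (\<lambda>x. x)" and x2: "integrable \<mu> (\<lambda>x. x\<^sup>2)"
    using mu.integrable_powr_imp[OF _ x] d by auto
  have xi: "integrable PX (\<lambda>x. x i)" "integrable PX (\<lambda>x. (x i)\<^sup>2)" "integrable PX (\<lambda>x. \<bar>x i\<bar> powr (2 + d))"
      "(\<integral> x. x i \<partial>PX) = 0" "(\<integral> x. (x i)\<^sup>2 \<partial>PX) = s" "(\<integral> x. \<bar>x i\<bar> powr (2 + d) \<partial>PX) = B" for i
  proof -
    have "has_bochner_integral PX (\<lambda>x. x i) (\<integral> x. x \<partial>\<mu>)"
      by (rule has_bochner_integral_component[OF _ has_bochner_integral_integrable[OF x1]]) simp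
    moreover have "has_bochner_integral PX (\<lambda>x. (x i)\<^sup>2) (\<integral> x. x\<^sup>2 \<partial>\<mu>)"
      by (rule has_bochner_integral_component[OF _ has_bochner_integral_integrable[OF x2]]) simp
    moreover have "has_bochner_integral PX (\<lambda>x. \<bar>x i\<bar> powr (2 + d)) (\<integral> x. \<bar>x\<bar> powr (2 + d) \<partial>\<mu>)"
      by (rule has_bochner_integral_component[OF _ has_bochner_integral_integrable[OF x]]) simp
    ultimately show "integrable PX (\<lambda>x. x i)" "integrable PX (\<lambda>x. (x i)\<^sup>2)"
      "integrable PX (\<lambda>x. \<bar>x i\<bar> powr (2 + d))" "(\<integral> x. x i \<partial>PX) = 0" "(\<integral> x. (x i)\<^sup>2 \<partial>PX) = s"
      "(\<integral> x. \<bar>x i\<bar> powr (2 + d) \<partial>PX) = B"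
      unfolding m s_def B_def has_bochner_integral_iff by blast+
  qed
  \<comment> \<open>Lyapunov's inequality: Jensen with exponent 1 + d/2 applied to x^2.\<close>
  have sB: "s powr (1 + d / 2) \<le> B"
    using mu.expectation_powr_le[of "1 + d / 2" "\<lambda>x. x\<^sup>2"] d x x2 unfolding square_powr_half
    by (simp add: s_def B_def)
  have "(\<integral> x. \<bar>\<Sum>i = 1..n. x i\<bar> powr (2 + d) \<partial>PX) \<le> (c + 1) * real n powr (1 + d / 2) * B"
  proof (induction n)
    case (Suc n)
    define T where "T = (\<lambda>x :: nat \<Rightarrow> real. \<Sum>i = 1..n. x i)"
    have Tm [measurable]: "T \<in> borel_measurable PX" unfolding T_def by simp
    have Tp: "integrable PX (\<lambda>x. \<bar>T x\<bar> powr (2 + d))"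
      unfolding T_def by (rule abs_moment_sum) (use d x in auto)
    have T1: "integrable PX (\<lambda>x. sgn (T x) * \<bar>T x\<bar> powr (1 + d))"
    proof (rule Bochner_Integration.integrable_bound)
      show "integrable PX (\<lambda>x. \<bar>T x\<bar> powr (1 + d))"
        by (rule PX.integrable_abs_powr_le[OF Tm Tp]) (use d in auto)
    qed (auto simp: abs_mult abs_sgn_eq)
    have Td: "integrable PX (\<lambda>x. \<bar>T x\<bar> powr d)"
      by (rule PX.integrable_abs_powr_le[OF Tm Tp]) (use d in auto)
    have indep: "PX.indep_var borel (\<lambda>x. g (x (Suc n))) borel (\<lambda>x. f (T x))"
      if "f \<in> borel_measurable borel" "g \<in> borel_measurable borel" for f g :: "real \<Rightarrow> real"
      using PX.indep_var_compose[OF indep_Suc that(2,1)] unfolding comp_def T_def .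
    have ind1: "PX.indep_var borel (\<lambda>x. x (Suc n)) borel (\<lambda>x. sgn (T x) * \<bar>T x\<bar> powr (1 + d))"
      by (rule indep[of "\<lambda>t. sgn t * \<bar>t\<bar> powr (1 + d)" "\<lambda>t. t"]) measurable
    have ind2: "PX.indep_var borel (\<lambda>x. (x (Suc n))\<^sup>2) borel (\<lambda>x. \<bar>T x\<bar> powr d)"
      by (rule indep[of "\<lambda>t. \<bar>t\<bar> powr d" "\<lambda>t. t\<^sup>2"]) measurable
    note i1 = PX.indep_var_integrable[OF ind1 xi(1) T1] and i2 = PX.indep_var_integrable[OF ind2 xi(2) Td]
    \<comment> \<open>Jensen with exponent 2/d compares |T|^d with T^2, whose mean is n s because
      the summands are centred and independent.\<close>
    have ETd: "(\<integral> x. \<bar>T x\<bar> powr d \<partial>PX) \<le> (real n * s) powr (d / 2)"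
    proof -
      have "(\<integral> x. \<bar>T x\<bar> powr d \<partial>PX) powr (2 / d) \<le> (\<integral> x. (\<bar>T x\<bar> powr d) powr (2 / d) \<partial>PX)"
        by (rule PX.expectation_powr_le) (use d Td moments_sum(2)[OF x2] in \<open>auto simp: powr_powr T_def\<close>)
      also have "\<dots> = real n * s"
        using d moments_sum(4)[OF x2] m by (simp add: powr_powr T_def s_def)
      finally have "((\<integral> x. \<bar>T x\<bar> powr d \<partial>PX) powr (2 / d)) powr (d / 2) \<le> (real n * s) powr (d / 2)"
        using d by (intro powr_mono2) auto
      then show ?thesis using d by (simp add: powr_powr)
    qed
    have "(\<integral> x. \<bar>\<Sum>i = 1..Suc n. x i\<bar> powr (2 + d) \<partial>PX) = (\<integral> x. \<bar>T x + x (Suc n)\<bar> powr (2 + d) \<partial>PX)"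
      by (simp add: T_def)
    also have "\<dots> \<le> (\<integral> x. \<bar>T x\<bar> powr (2 + d) + (2 + d) * (x (Suc n) * (sgn (T x) * \<bar>T x\<bar> powr (1 + d)))
            + c * ((x (Suc n))\<^sup>2 * \<bar>T x\<bar> powr d) + \<bar>x (Suc n)\<bar> powr (2 + d) \<partial>PX)"
    proof (rule integral_mono)
      show "integrable PX (\<lambda>x. \<bar>T x + x (Suc n)\<bar> powr (2 + d))"
        using abs_moment_sum(1)[of "2 + d" "Suc n"] d x by (simp add: T_def)
      show "\<bar>T x + x (Suc n)\<bar> powr (2 + d) \<le> \<bar>T x\<bar> powr (2 + d) + (2 + d) * (x (Suc n) * (sgn (T x) * \<bar>T x\<bar> powr (1 + d)))
            + c * ((x (Suc n))\<^sup>2 * \<bar>T x\<bar> powr d) + \<bar>x (Suc n)\<bar> powr (2 + d)" for x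
        using abs_powr_taylor_le[OF d, of "T x" "x (Suc n)"] by (simp add: c_def mult_ac)
    qed (intro Bochner_Integration.integrable_add integrable_mult_right Tp i1 i2 xi)
    also have "\<dots> = (\<integral> x. \<bar>T x\<bar> powr (2 + d) \<partial>PX) + c * (s * (\<integral> x. \<bar>T x\<bar> powr d \<partial>PX)) + B"
      using Tp i1 i2 xi PX.indep_var_lebesgue_integral[OF ind1 xi(1) T1]
        PX.indep_var_lebesgue_integral[OF ind2 xi(2) Td] by simp
    also have "\<dots> \<le> (c + 1) * real n powr (1 + d / 2) * B + c * (s * (real n * s) powr (d / 2)) + B"
      using Suc ETd s0 c0 unfolding T_def by (intro add_mono mult_left_mono mult_right_mono) auto
    also have "s * (real n * s) powr (d / 2) = real n powr (d / 2) * s powr (1 + d / 2)"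
      using s0 by (simp add: powr_mult powr_add)
    \<comment> \<open>Both increments are raised to multiples of (n+1)^(d/2) B. The induction then
      closes through n (n+1)^(d/2) + (n+1)^(d/2) = (n+1)^(1+d/2).\<close>
    also have "(c + 1) * real n powr (1 + d / 2) * B + c * (real n powr (d / 2) * s powr (1 + d / 2)) + B \<le>
        (c + 1) * real n powr (1 + d / 2) * B + c * (real (Suc n) powr (d / 2) * B) + real (Suc n) powr (d / 2) * B"
    proof -
      have "1 powr (d / 2) \<le> real (Suc n) powr (d / 2)" using d by (intro powr_mono2) auto
      then have "1 * B \<le> real (Suc n) powr (d / 2) * B" using B0 by (intro mult_right_mono) auto
      moreover have "real n powr (d / 2) * s powr (1 + d / 2) \<le> real (Suc n) powr (d / 2) * B"
        using d sB by (intro mult_mono powr_mono2) auto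
      ultimately show ?thesis using c0 by (intro add_mono mult_left_mono) auto
    qed
    also have "\<dots> = (c + 1) * (real n * real n powr (d / 2) + real (Suc n) powr (d / 2)) * B"
      by (simp add: powr_add algebra_simps)
    also have "\<dots> \<le> (c + 1) * (real n * real (Suc n) powr (d / 2) + real (Suc n) powr (d / 2)) * B"
      using c0 B0 d by (intro mult_left_mono mult_right_mono add_mono powr_mono2) auto
    also have "real n * real (Suc n) powr (d / 2) + real (Suc n) powr (d / 2) = real (Suc n) powr (1 + d / 2)"
      by (simp add: powr_add algebra_simps)
    finally show ?case .
  qed simp
  then show ?thesis by (simp add: c_def B_def)
qed

end

section \<open>Compound Poisson laws\<close>

text \<open>The Stein-Chen identity E[K f(K)] = r E f(K+1). It rests on (k+1) P(K = k+1) = r P(K =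
  k), and the term k = 0 vanishes because of the factor k. Extended nonnegative values spare any
  integrability assumption on \<open>f\<close>.\<close>

lemma nn_integral_poisson_shift:
  assumes r: "r > 0"
  shows "(\<integral>\<^sup>+ k. of_nat k * f k \<partial>measure_pmf (poisson_pmf r)) =
    ennreal r * (\<integral>\<^sup>+ k. f (Suc k) \<partial>measure_pmf (poisson_pmf r))"
proof -
  have *: "ennreal (pmf (poisson_pmf r) (Suc k)) * (of_nat (Suc k) * f (Suc k)) =
      ennreal r * (ennreal (pmf (poisson_pmf r) k) * f (Suc k))" for k
  proof -
    have "pmf (poisson_pmf r) (Suc k) * real (Suc k) = r * pmf (poisson_pmf r) k"
      using r by (simp add: field_simps del: of_nat_Suc)
    then have "ennreal (pmf (poisson_pmf r) (Suc k)) * of_nat (Suc k) = ennreal r * ennreal (pmf (poisson_pmf r) k)"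
      using r by (metis ennreal_mult ennreal_of_nat_eq_real_of_nat less_imp_le of_nat_0_le_iff pmf_nonneg)
    then show ?thesis by (metis mult.assoc)
  qed
  have "(\<lambda>k. ennreal (pmf (poisson_pmf r) (Suc k)) * (of_nat (Suc k) * f (Suc k))) sums
      (ennreal r * (\<integral>\<^sup>+ k. f (Suc k) \<partial>measure_pmf (poisson_pmf r)))"
    unfolding * nn_integral_measure_pmf nn_integral_count_space_nat
    by (subst ennreal_suminf_cmult[symmetric]) (rule summable_sums, simp)
  from sums_Suc[OF this] show ?thesis
    unfolding nn_integral_measure_pmf nn_integral_count_space_nat by (simp add: sums_iff)
qed

lemma has_bochner_integral_poisson_shift:
  fixes f :: "nat \<Rightarrow> real"
  assumes r: "r > 0" and f: "\<And>k. f k \<ge> 0"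
    and c: "has_bochner_integral (measure_pmf (poisson_pmf r)) (\<lambda>k. f (Suc k)) c"
  shows "has_bochner_integral (measure_pmf (poisson_pmf r)) (\<lambda>k. real k * f k) (r * c)"
proof (rule has_bochner_integral_nn_integral)
  have c0: "c \<ge> 0" and i: "integrable (measure_pmf (poisson_pmf r)) (\<lambda>k. f (Suc k))"
    using c f by (auto simp: has_bochner_integral_iff)
  show "0 \<le> r * c" using r c0 by simp
  have "(\<integral>\<^sup>+ k. ennreal (real k * f k) \<partial>measure_pmf (poisson_pmf r)) =
      (\<integral>\<^sup>+ k. of_nat k * ennreal (f k) \<partial>measure_pmf (poisson_pmf r))"
    using f by (simp add: ennreal_mult ennreal_of_nat_eq_real_of_nat)
  also have "\<dots> = ennreal r * (\<integral>\<^sup>+ k. ennreal (f (Suc k)) \<partial>measure_pmf (poisson_pmf r))"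
    by (rule nn_integral_poisson_shift[OF r])
  also have "(\<integral>\<^sup>+ k. ennreal (f (Suc k)) \<partial>measure_pmf (poisson_pmf r)) = ennreal c"
    using c f i by (subst nn_integral_eq_integral) (auto simp: has_bochner_integral_iff)
  finally show "(\<integral>\<^sup>+ k. ennreal (real k * f k) \<partial>measure_pmf (poisson_pmf r)) = ennreal (r * c)"
    using r c0 by (simp add: ennreal_mult)
qed (use f in auto)

text \<open>The shift identity is iterated with f = 1, k, k^2. The third moment is needed as a
  common bound for the moments of order 2 + d <= 3; what matters about it is that it equals r +
  O(r^2) for small r.\<close>

lemma poisson_moments:
  assumes r: "r > 0"
  shows "has_bochner_integral (measure_pmf (poisson_pmf r)) (\<lambda>k. real k) r"
    "has_bochner_integral (measure_pmf (poisson_pmf r)) (\<lambda>k. (real k)\<^sup>2) (r + r\<^sup>2)"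
    "has_bochner_integral (measure_pmf (poisson_pmf r)) (\<lambda>k. (real k) ^ 3) (r + 3 * r\<^sup>2 + r ^ 3)"
proof -
  note shift = has_bochner_integral_poisson_shift[OF r]
  have 0: "has_bochner_integral (measure_pmf (poisson_pmf r)) (\<lambda>k. 1 :: real) 1"
    by (simp add: has_bochner_integral_iff)
  have 1: "has_bochner_integral (measure_pmf (poisson_pmf r)) (\<lambda>k. real k) r"
    using shift[of "\<lambda>_. 1", OF _ 0] by simp
  then show "has_bochner_integral (measure_pmf (poisson_pmf r)) (\<lambda>k. real k) r" .
  have "has_bochner_integral (measure_pmf (poisson_pmf r)) (\<lambda>k. real (Suc k)) (r + 1)"
    using has_bochner_integral_add[OF 1 0] by (simp add: add.commute)
  from shift[OF _ this] have 2: "has_bochner_integral (measure_pmf (poisson_pmf r)) (\<lambda>k. (real k)\<^sup>2) (r + r\<^sup>2)"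
    by (simp add: power2_eq_square algebra_simps)
  then show "has_bochner_integral (measure_pmf (poisson_pmf r)) (\<lambda>k. (real k)\<^sup>2) (r + r\<^sup>2)" .
  have "has_bochner_integral (measure_pmf (poisson_pmf r)) (\<lambda>k. (real k)\<^sup>2 + 2 * real k + 1) (r + r\<^sup>2 + 2 * r + 1)"
    by (intro has_bochner_integral_add has_bochner_integral_mult_right 0 1 2)
  also have "(\<lambda>k. (real k)\<^sup>2 + 2 * real k + 1) = (\<lambda>k. (real (Suc k))\<^sup>2)"
    by (auto simp: power2_eq_square algebra_simps)
  finally show "has_bochner_integral (measure_pmf (poisson_pmf r)) (\<lambda>k. (real k) ^ 3) (r + 3 * r\<^sup>2 + r ^ 3)"
    using shift[of "\<lambda>k. (real k)\<^sup>2" "r + r\<^sup>2 + 2 * r + 1"]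
    by (simp add: power2_eq_square power3_eq_cube algebra_simps)
qed

text \<open>Stated on the whole closed complex unit disc so that the value of a characteristic
  function may be substituted for \<open>z\<close>.\<close>

lemma poisson_pgf:
  fixes z :: complex
  assumes r: "r > 0" and z: "norm z \<le> 1"
  shows "(\<integral> k. z ^ k \<partial>measure_pmf (poisson_pmf r)) = exp (of_real r * (z - 1))"
proof -
  have int: "integrable (measure_pmf (poisson_pmf r)) (\<lambda>k. z ^ k)"
    using z by (intro measure_pmf.integrable_const_bound[where B = 1]) (auto simp: norm_power power_le_one)
  have "integrable (count_space UNIV) (\<lambda>k. pmf (poisson_pmf r) k *\<^sub>R z ^ k)"
    using int unfolding measure_pmf_eq_density by (subst (asm) integrable_density) auto
  from sums_integral_count_space_nat[OF this]
  have "(\<lambda>k. pmf (poisson_pmf r) k *\<^sub>R z ^ k) sums (\<integral> k. z ^ k \<partial>measure_pmf (poisson_pmf r))"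
    unfolding measure_pmf_eq_density by (subst integral_density) auto
  moreover have "(\<lambda>k. of_real (exp (- r)) * ((of_real r * z) ^ k /\<^sub>R fact k)) sums (of_real (exp (- r)) * exp (of_real r * z))"
    by (intro sums_mult exp_converges)
  moreover have "pmf (poisson_pmf r) k *\<^sub>R z ^ k = of_real (exp (- r)) * ((of_real r * z) ^ k /\<^sub>R fact k)" for k
    using r by (simp add: scaleR_conv_of_real power_mult_distrib field_simps)
  ultimately have "(\<integral> k. z ^ k \<partial>measure_pmf (poisson_pmf r)) = of_real (exp (- r)) * exp (of_real r * z)"
    using sums_unique2 by simp
  also have "\<dots> = exp (of_real r * (z - 1))"
    by (simp add: exp_of_real[symmetric] mult_exp_exp algebra_simps)
  finally show ?thesis .
qed

section \<open>Characteristic functions and divisibility of compound Poisson laws\<close>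

lemma random_sum_poisson:
  assumes "prob_space \<mu>" "sets \<mu> = sets borel"
  shows "random_sum (measure_pmf (poisson_pmf r)) \<mu>"
  using assms by (simp add: random_sum_def measure_pmf.prob_space_axioms)

lemma char_random_sum:
  assumes "random_sum \<nu> \<mu>"
  shows "char (random_sum_law \<nu> \<mu>) t = (\<integral> n. char \<mu> t ^ n \<partial>\<nu>)"
  unfolding char_def
  by (rule random_sum.integral_multiplicative[OF assms])
     (auto simp: exp_add[symmetric] algebra_simps)

lemma real_distributionI:
  fixes \<mu> :: "real measure"
  assumes "prob_space \<mu>" "sets \<mu> = sets borel"
  shows "real_distribution \<mu>"
  using assms sets_eq_imp_space_eq[of \<mu> borel] by (simp add: real_distribution_def real_distribution_axioms_def)

lemma char_compound_poisson:
  assumes "r > 0" "prob_space \<mu>" "sets \<mu> = sets borel"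
  shows "char (random_sum_law (measure_pmf (poisson_pmf r)) \<mu>) t = exp (of_real r * (char \<mu> t - 1))"
proof -
  interpret real_distribution \<mu> using assms by (intro real_distributionI)
  show ?thesis
    by (simp add: char_random_sum[OF random_sum_poisson[OF assms(2,3)]] poisson_pgf assms(1) cmod_char_le_1)
qed

text \<open>The intensity enters exp(lam (char - 1)) linearly in the exponent, so this
  characteristic function is the n-th power of the one with intensity lam / n. The sum is taken on
  the infinite product, which is the space on which Berry-Esseen is applied later.\<close>

lemma compound_poisson_split:
  fixes \<mu> :: "real measure"
  assumes lam: "lam > 0" and \<mu>: "prob_space \<mu>" "sets \<mu> = sets borel" and n: "n \<ge> (1::nat)"
  defines "V \<equiv> random_sum_law (measure_pmf (poisson_pmf (lam / real n))) \<mu>"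
  shows "distr (\<Pi>\<^sub>M i\<in>(UNIV::nat set). V) borel (\<lambda>x. \<Sum>i = 1..n. x i) =
    random_sum_law (measure_pmf (poisson_pmf lam)) \<mu>"
proof (rule Levy_uniqueness)
  interpret A: random_sum "measure_pmf (poisson_pmf lam)" \<mu> by (rule random_sum_poisson[OF \<mu>])
  interpret B: random_sum "measure_pmf (poisson_pmf (lam / real n))" \<mu> by (rule random_sum_poisson[OF \<mu>])
  interpret V: random_sum "measure_pmf (poisson_pmf lam)" V
    unfolding V_def by (rule random_sum_poisson[OF B.prob_R B.sets_R])
  show "real_distribution (random_sum_law (measure_pmf (poisson_pmf lam)) \<mu>)"
    by (intro real_distributionI A.prob_R A.sets_R)
  show "real_distribution (distr (\<Pi>\<^sub>M i\<in>(UNIV::nat set). V) borel (\<lambda>x. \<Sum>i = 1..n. x i))"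
    by (intro real_distributionI V.PX.prob_space_distr V.measurable_sum_PX) simp
  have "char (distr (\<Pi>\<^sub>M i\<in>(UNIV::nat set). V) borel (\<lambda>x. \<Sum>i = 1..n. x i)) t =
      char (random_sum_law (measure_pmf (poisson_pmf lam)) \<mu>) t" for t
  proof -
    have "distr (\<Pi>\<^sub>M i\<in>(UNIV::nat set). V) borel (\<lambda>x. x i) = V" for i
      using distr_PiM_component[of UNIV "\<lambda>_. V" i] V.prob_mu V.sets_mu by (metis UNIV_I distr_cong)
    then have "char (distr (\<Pi>\<^sub>M i\<in>(UNIV::nat set). V) borel (\<lambda>x. \<Sum>i = 1..n. x i)) t = (\<Prod>i = 1..n. char V t)"
      by (subst V.PX.char_distr_sum[OF V.indep_PX]) simp
    also have "\<dots> = exp (of_real (lam / n) * (char \<mu> t - 1)) ^ n"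
      using lam n \<mu> by (simp add: V_def char_compound_poisson)
    also have "\<dots> = exp (of_real lam * (char \<mu> t - 1))"
      using n by (simp flip: exp_of_nat_mult)
    also have "\<dots> = char (random_sum_law (measure_pmf (poisson_pmf lam)) \<mu>) t"
      by (simp only: char_compound_poisson[OF lam \<mu>])
    finally show ?thesis .
  qed
  then show "char (distr (\<Pi>\<^sub>M i\<in>(UNIV::nat set). V) borel (\<lambda>x. \<Sum>i = 1..n. x i)) =
      char (random_sum_law (measure_pmf (poisson_pmf lam)) \<mu>)" by auto
qed

text \<open>The Kolmogorov distance uses strict inequality and \<open>cdf\<close> the weak one; they
  agree here because the normal law has no atom at \<open>x\<close>.\<close>

lemma prob_less_std_normal:
  assumes "prob_space P" and Z: "distributed P lborel Z std_normal_density"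
  shows "\<P>(\<omega> in P. Z \<omega> < x) = cdf std_normal_distribution x"
proof -
  interpret P: prob_space P by fact
  have Zm [measurable]: "Z \<in> borel_measurable P"
    using distributed_measurable[OF Z] by simp
  have "\<P>(\<omega> in P. Z \<omega> < x) = measure (distr P lborel Z) {..<x}"
    by (subst measure_distr) (auto intro!: arg_cong[where f="measure P"])
  also have "distr P lborel Z = std_normal_distribution" by (rule distributed_distr_eq_density[OF Z])
  also have "measure std_normal_distribution {..<x} = measure std_normal_distribution {..x}"
  proof (rule measure_eq_AE)
    have "AE y in lborel. y \<noteq> x" by (rule AE_lborel_singleton)
    then have "AE y in std_normal_distribution. y \<noteq> x"
      by (subst AE_density) auto
    then show "AE y in std_normal_distribution. y \<in> {..<x} \<longleftrightarrow> y \<in> {..x}"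
      by eventually_elim auto
  qed auto
  finally show ?thesis by (simp add: cdf_def)
qed

section \<open>Moments of compound Poisson laws, with sharp asymptotics at small intensity\<close>

text \<open>A Poisson number has mean and variance both equal to r, so the variance of the sum, E N
  Var W + Var N (E W)^2, collapses to r E W^2.\<close>

lemma compound_poisson_moments:
  fixes \<mu> :: "real measure"
  assumes r: "r > 0" and \<mu>: "prob_space \<mu>" "sets \<mu> = sets borel" and x: "integrable \<mu> (\<lambda>x. x\<^sup>2)"
  defines "V \<equiv> random_sum_law (measure_pmf (poisson_pmf r)) \<mu>"
  shows "integrable V (\<lambda>v. v)" "integrable V (\<lambda>v. v\<^sup>2)"
    "(\<integral> v. v \<partial>V) = r * (\<integral> x. x \<partial>\<mu>)"
    "(\<integral> v. (v - r * (\<integral> x. x \<partial>\<mu>))\<^sup>2 \<partial>V) = r * (\<integral> x. x\<^sup>2 \<partial>\<mu>)"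
proof -
  interpret A: real_random_sum "measure_pmf (poisson_pmf r)" \<mu>
    unfolding real_random_sum_def by (rule random_sum_poisson[OF \<mu>])
  interpret V: prob_space V unfolding V_def by (rule A.prob_R)
  have p: "integrable (measure_pmf (poisson_pmf r)) (\<lambda>k. (real k)\<^sup>2)"
    "(\<integral> k. real k \<partial>measure_pmf (poisson_pmf r)) = r"
    "(\<integral> k. (real k)\<^sup>2 \<partial>measure_pmf (poisson_pmf r)) = r + r\<^sup>2"
    using poisson_moments[OF r] by (auto simp: has_bochner_integral_iff)
  note * = A.moments_R[OF x p(1), folded V_def]
  show i: "integrable V (\<lambda>v. v)" "integrable V (\<lambda>v. v\<^sup>2)" by (fact *)+
  show m: "(\<integral> v. v \<partial>V) = r * (\<integral> x. x \<partial>\<mu>)" using *(3) p by simp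
  show "(\<integral> v. (v - r * (\<integral> x. x \<partial>\<mu>))\<^sup>2 \<partial>V) = r * (\<integral> x. x\<^sup>2 \<partial>\<mu>)"
    using V.variance_eq[OF i] *(4) unfolding m p
    by (simp add: power_mult_distrib algebra_simps)
qed

text \<open>To first order in \<open>h\<close> only a single jump matters, and there the bound k^p
  E|W|^p for k jumps is exact. For natural k and p <= 3 one has k^p <= k^3, whose Poisson mean is h
  (1 + 3 h + h^2). Dividing the right-hand side by \<open>h\<close> and letting \<open>h\<close>
  tend to 0 therefore leaves exactly E|W|^p.\<close>

lemma compound_poisson_centered_moment_le:
  fixes \<mu> :: "real measure"
  assumes h: "0 < h" "h < 1" and \<mu>: "prob_space \<mu>" "sets \<mu> = sets borel"
    and p: "2 \<le> p" "p \<le> 3" and x: "integrable \<mu> (\<lambda>x. \<bar>x\<bar> powr p)"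
  defines "V \<equiv> random_sum_law (measure_pmf (poisson_pmf h)) \<mu>"
  shows "integrable V (\<lambda>v. \<bar>v - h * m\<bar> powr p)"
    "(\<integral> v. \<bar>v - h * m\<bar> powr p \<partial>V) \<le>
      h * ((1 - sqrt h) powr (1 - p) * (1 + 3 * h + h\<^sup>2) * (\<integral> x. \<bar>x\<bar> powr p \<partial>\<mu>)
           + sqrt h powr (p - 1) * \<bar>m\<bar> powr p)"
proof -
  interpret A: real_random_sum "measure_pmf (poisson_pmf h)" \<mu>
    unfolding real_random_sum_def by (rule random_sum_poisson[OF \<mu>])
  interpret V: prob_space V unfolding V_def by (rule A.prob_R)
  have le3: "real k powr p \<le> real k ^ 3" for k
  proof (cases "k = 0")
    case False
    then have "real k powr p \<le> real k powr 3" using p by (intro powr_mono) auto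
    then show ?thesis using False by simp
  qed simp
  have k3: "integrable (measure_pmf (poisson_pmf h)) (\<lambda>k. real k ^ 3)"
    "(\<integral> k. real k ^ 3 \<partial>measure_pmf (poisson_pmf h)) = h + 3 * h\<^sup>2 + h ^ 3"
    using poisson_moments[OF h(1)] by (auto simp: has_bochner_integral_iff)
  have kp: "integrable (measure_pmf (poisson_pmf h)) (\<lambda>k. real k powr p)"
    by (rule Bochner_Integration.integrable_bound[OF k3(1)]) (use le3 in auto)
  have kp_le: "(\<integral> k. real k powr p \<partial>measure_pmf (poisson_pmf h)) \<le> h + 3 * h\<^sup>2 + h ^ 3"
    unfolding k3(2)[symmetric] using le3 by (intro integral_mono kp k3)
  have v: "integrable V (\<lambda>v. \<bar>v\<bar> powr p)"
    "(\<integral> v. \<bar>v\<bar> powr p \<partial>V) \<le> (\<integral> k. real k powr p \<partial>measure_pmf (poisson_pmf h)) * (\<integral> x. \<bar>x\<bar> powr p \<partial>\<mu>)"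
    using A.abs_moment_R[OF _ x kp] p by (auto simp: V_def)
  have t: "0 < sqrt h" "sqrt h < 1" using h by (auto simp: real_sqrt_lt_1_iff)
  (* The weight sqrt h in powr_diff_le makes the contribution of h * m of smaller order than h. *)
  define W where "W v = (1 - sqrt h) powr (1 - p) * \<bar>v\<bar> powr p + sqrt h powr (1 - p) * \<bar>h * m\<bar> powr p" for v
  have le: "\<bar>v - h * m\<bar> powr p \<le> W v" for v
    using powr_diff_le[of p "sqrt h" v "h * m"] p t by (simp add: W_def)
  have iW: "integrable V W" using v unfolding W_def by simp
  show i: "integrable V (\<lambda>v. \<bar>v - h * m\<bar> powr p)"
    by (rule Bochner_Integration.integrable_bound[OF iW])
       (use le in \<open>auto simp: V_def W_def intro!: AE_I2 order_trans[OF le]\<close>)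
  have "(\<integral> v. \<bar>v - h * m\<bar> powr p \<partial>V) \<le> (\<integral> v. W v \<partial>V)"
    using le by (intro integral_mono i iW)
  also have "\<dots> = (1 - sqrt h) powr (1 - p) * (\<integral> v. \<bar>v\<bar> powr p \<partial>V) + sqrt h powr (1 - p) * \<bar>h * m\<bar> powr p"
    unfolding W_def using v(1) by (simp add: V.prob_space)
  also have "\<dots> \<le> (1 - sqrt h) powr (1 - p) * ((h + 3 * h\<^sup>2 + h ^ 3) * (\<integral> x. \<bar>x\<bar> powr p \<partial>\<mu>)) + sqrt h powr (1 - p) * \<bar>h * m\<bar> powr p"
    by (intro add_mono mult_left_mono order_trans[OF v(2)] mult_right_mono kp_le) auto
  \<comment> \<open>h^p = h (sqrt h)^(2(p-1)), and half of these p - 1 extra powers of h pay for the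
    weight (sqrt h)^(1-p). The other half keeps the term of smaller order than h.\<close>
  also have "sqrt h powr (1 - p) * \<bar>h * m\<bar> powr p = h * (sqrt h powr (p - 1) * \<bar>m\<bar> powr p)"
  proof -
    have "h powr p = h * (sqrt h powr (p - 1) * sqrt h powr (p - 1))"
      using h by (simp add: powr_diff powr_half_sqrt[symmetric] powr_powr flip: powr_add)
    moreover have "sqrt h powr (1 - p) * sqrt h powr (p - 1) = 1"
      using t by (simp flip: powr_add)
    ultimately show ?thesis using h by (simp add: abs_mult powr_mult)
  qed
  finally show "(\<integral> v. \<bar>v - h * m\<bar> powr p \<partial>V) \<le>
      h * ((1 - sqrt h) powr (1 - p) * (1 + 3 * h + h\<^sup>2) * (\<integral> x. \<bar>x\<bar> powr p \<partial>\<mu>)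
           + sqrt h powr (p - 1) * \<bar>m\<bar> powr p)"
    by (simp add: algebra_simps power2_eq_square power3_eq_cube)
qed

section \<open>Kolmogorov distance of compound Poisson laws to the normal law\<close>

text \<open>Boundedness makes the \<open>SUP\<close> of reals a genuine supremum, as
  \<open>cSUP_upper2\<close> requires.\<close>

lemma kolmogorov_bounded:
  assumes "prob_space P" "prob_space Q"
  shows "bdd_above (range (\<lambda>x::real. \<bar>\<P>(\<omega> in P. f x \<omega>) - \<P>(\<omega> in Q. g x \<omega>)\<bar>))"
proof (rule bdd_aboveI2)
  interpret P: prob_space P by fact
  interpret Q: prob_space Q by fact
  show "\<bar>\<P>(\<omega> in P. f x \<omega>) - \<P>(\<omega> in Q. g x \<omega>)\<bar> \<le> 1" for x
    using P.prob_le_1[of "{\<omega> \<in> space P. f x \<omega>}"] Q.prob_le_1[of "{\<omega> \<in> space Q. g x \<omega>}"]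
      measure_nonneg[of P "{\<omega> \<in> space P. f x \<omega>}"] measure_nonneg[of Q "{\<omega> \<in> space Q. g x \<omega>}"]
    by linarith
qed

lemma kolmogorov_dist_nonneg:
  assumes "prob_space P" "prob_space Q"
  shows "0 \<le> kolmogorov_dist P \<xi> Q \<eta>"
  unfolding kolmogorov_dist_def
  by (rule cSUP_upper2[OF kolmogorov_bounded[OF assms], of 0]) simp_all

text \<open>The distance depends on \<open>S\<close> only through its law, so \<open>S\<close> may
  be replaced by a sum of coordinates on the infinite product of \<open>V\<close>. Its outcomes have
  type \<open>nat \<Rightarrow> real\<close>, the type over which \<open>berry_esseen_const\<close>
  quantifies.\<close>

lemma compound_poisson_kolmogorov_le_step:
  fixes PS :: "'s measure" and S :: "'s \<Rightarrow> real" and \<mu> :: "real measure"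
  assumes be: "berry_esseen_const s d c" and d: "0 < d" "d \<le> 1"
    and \<mu>: "prob_space \<mu>" "sets \<mu> = sets borel"
    and x: "integrable \<mu> (\<lambda>x. \<bar>x\<bar> powr (2 + d))"
    and lam: "lam > 0"
    and S: "prob_space PS" "S \<in> borel_measurable PS"
      "distr PS borel S = random_sum_law (measure_pmf (poisson_pmf lam)) \<mu>"
    and Z: "prob_space PZ" "distributed PZ lborel Z std_normal_density"
    and n: "n \<ge> (1::nat)" "lam / real n < 1"
  defines "m \<equiv> \<integral> x. x \<partial>\<mu>" and "q \<equiv> \<integral> x. x\<^sup>2 \<partial>\<mu>"
  defines "V \<equiv> random_sum_law (measure_pmf (poisson_pmf (lam / real n))) \<mu>"
  assumes q: "q > 0"
  shows "kolmogorov_dist PS (\<lambda>\<omega>. (S \<omega> - lam * m) / sqrt (lam * q)) PZ Z \<le>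
    c / real n powr (d / 2) *
      ((\<integral> v. \<bar>v - lam / real n * m\<bar> powr (2 + d) \<partial>V) / sqrt (lam / real n * q) powr (2 + d) + s)"
proof -
  define h where "h = lam / real n"
  have h: "h > 0" "h < 1" "real n * h = lam" using lam n by (auto simp: h_def)
  interpret \<mu>: prob_space \<mu> by fact
  interpret A: random_sum "measure_pmf (poisson_pmf h)" \<mu> by (rule random_sum_poisson[OF \<mu>])
  interpret V: random_sum "measure_pmf (poisson_pmf h)" V
    unfolding V_def h_def[symmetric] by (rule random_sum_poisson[OF A.prob_R A.sets_R])
  define Y where "Y i x = x i - h * m" for i :: nat and x :: "nat \<Rightarrow> real"
  have [measurable]: "(\<lambda>x. x) \<in> borel_measurable \<mu>" using \<mu>(2) by (simp cong: measurable_cong_sets)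
  have x2: "integrable \<mu> (\<lambda>x. x\<^sup>2)" using \<mu>.integrable_powr_imp[OF _ x] d by auto
  note mV = compound_poisson_moments[OF h(1) \<mu> x2, folded m_def q_def, folded V_def[folded h_def]]
  note cV = compound_poisson_centered_moment_le[OF h(1,2) \<mu> _ _ x, of m, folded V_def[folded h_def]]
  have int: "(\<integral> x. f (x i) \<partial>V.PX) = (\<integral> v. f v \<partial>V)" if "f \<in> borel_measurable borel" for f :: "real \<Rightarrow> real" and i
    by (rule V.integral_component(1)[OF that])
  have inti: "integrable V.PX (\<lambda>x. f (x i)) \<longleftrightarrow> integrable V f" if "f \<in> borel_measurable borel" for f :: "real \<Rightarrow> real" and i
    by (rule V.integral_component(2)[OF that])
  have indep: "V.PX.indep_vars (\<lambda>_. borel) Y {1..n}"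
    using V.PX.indep_vars_compose2[OF V.indep_PX[of "{1..n}"], of "\<lambda>_ v. v - h * m" "\<lambda>_. borel"]
    unfolding Y_def by simp
  have same: "\<forall>i\<in>{1..n}. distr V.PX borel (Y i) = distr V.PX borel (Y 1)"
  proof
    fix i
    have "distr V.PX borel (Y j) = distr V borel (\<lambda>v. v - h * m)" for j
    proof -
      have "distr V borel (\<lambda>v. v - h * m) = distr (distr V.PX V (\<lambda>x. x j)) borel (\<lambda>v. v - h * m)"
        using distr_PiM_component[of UNIV "\<lambda>_. V" j] V.prob_mu by simp
      also have "\<dots> = distr V.PX borel ((\<lambda>v. v - h * m) \<circ> (\<lambda>x. x j))"
        by (rule distr_distr) measurable
      also have "(\<lambda>v. v - h * m) \<circ> (\<lambda>x. x j) = Y j"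
        by (rule ext) (simp only: comp_def Y_def)
      finally show ?thesis ..
    qed
    then show "distr V.PX borel (Y i) = distr V.PX borel (Y 1)" by metis
  qed
  have "(\<integral> x. Y 1 x \<partial>V.PX) = (\<integral> v. v - h * m \<partial>V)"
    unfolding Y_def by (rule int) measurable
  also have "\<dots> = 0" using mV V.mu.prob_space by simp
  finally have mean: "(\<integral> x. Y 1 x \<partial>V.PX) = 0" .
  have "(\<integral> x. (Y 1 x)\<^sup>2 \<partial>V.PX) = (\<integral> v. (v - h * m)\<^sup>2 \<partial>V)"
    unfolding Y_def by (rule int) measurable
  also have "\<dots> = (sqrt (h * q))\<^sup>2" using mV(4) h q by simp
  finally have var: "(\<integral> x. (Y 1 x)\<^sup>2 \<partial>V.PX) = (sqrt (h * q))\<^sup>2" .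
  have "integrable V.PX (\<lambda>x. \<bar>Y 1 x\<bar> powr (2 + d)) \<longleftrightarrow> integrable V (\<lambda>v. \<bar>v - h * m\<bar> powr (2 + d))"
    unfolding Y_def by (rule inti) measurable
  then have pint: "integrable V.PX (\<lambda>x. \<bar>Y 1 x\<bar> powr (2 + d))" using cV(1) d by simp
  have pmom: "(\<integral> x. \<bar>Y 1 x\<bar> powr (2 + d) \<partial>V.PX) = (\<integral> v. \<bar>v - h * m\<bar> powr (2 + d) \<partial>V)"
    unfolding Y_def by (rule int) measurable
  have hq: "sqrt (h * q) > 0" using h q by simp
  have "(SUP x::real. \<bar>\<P>(\<omega> in V.PX. (\<Sum>i = 1..n. Y i \<omega>) < x * sqrt (h * q) * sqrt (real n))
                        - cdf std_normal_distribution x\<bar>)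
          \<le> c / real n powr (d / 2) *
             ((\<integral> x. \<bar>Y 1 x\<bar> powr (2 + d) \<partial>V.PX) / sqrt (h * q) powr (2 + d) + s)"
    using be[unfolded berry_esseen_const_def, THEN spec[of _ V.PX], THEN spec[of _ Y], THEN spec[of _ n],
        THEN spec[of _ "sqrt (h * q)"]] V.PX.prob_space_axioms n(1) indep same mean hq var pint
    by (elim impE) assumption+
  \<comment> \<open>The normalisations match because n h = lam: the centrings add up to lam m, and
    sqrt(h q) sqrt n = sqrt(lam q). Both events then say that the uncentred total lies below the
    same level, which the law determines.\<close>
  moreover have "\<P>(\<omega> in V.PX. (\<Sum>i = 1..n. Y i \<omega>) < x * sqrt (h * q) * sqrt (real n)) =
      \<P>(\<omega> in PS. (S \<omega> - lam * m) / sqrt (lam * q) < x)" for x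
  proof -
    have s: "sqrt (h * q) * sqrt (real n) = sqrt (lam * q)"
      using h by (simp add: real_sqrt_mult[symmetric] mult_ac)
    have sp: "sqrt (lam * q) > 0" using lam q by simp
    have "\<P>(\<omega> in V.PX. (\<Sum>i = 1..n. Y i \<omega>) < x * sqrt (h * q) * sqrt (real n)) =
        \<P>(\<omega> in V.PX. (\<Sum>i = 1..n. \<omega> i) < x * sqrt (lam * q) + lam * m)"
    proof -
      have "(\<Sum>i = 1..n. Y i \<omega>) = (\<Sum>i = 1..n. \<omega> i) - lam * m" for \<omega>
        unfolding Y_def sum_subtractf h(3)[symmetric] by simp
      then show ?thesis unfolding mult.assoc s by (simp only: diff_less_eq)
    qed
    also have "\<dots> = measure (distr V.PX borel (\<lambda>x. \<Sum>i = 1..n. x i)) {..<x * sqrt (lam * q) + lam * m}"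
      by (subst measure_distr[OF V.measurable_sum_PX]) (simp_all add: vimage_def Int_def conj_commute)
    also have "distr V.PX borel (\<lambda>x. \<Sum>i = 1..n. x i) = distr PS borel S"
      unfolding S V_def by (rule compound_poisson_split[OF lam \<mu> n(1)])
    also have "measure \<dots> {..<x * sqrt (lam * q) + lam * m} = \<P>(\<omega> in PS. S \<omega> < x * sqrt (lam * q) + lam * m)"
      by (subst measure_distr[OF S(2)]) (simp_all add: vimage_def Int_def conj_commute)
    also have "\<dots> = \<P>(\<omega> in PS. (S \<omega> - lam * m) / sqrt (lam * q) < x)"
      using sp by (simp add: pos_divide_less_eq diff_less_eq)
    finally show ?thesis .
  qed
  ultimately show ?thesis
    unfolding kolmogorov_dist_def prob_less_std_normal[OF Z] pmom h_def by simp
qed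

text \<open>That \<open>c\<close> is nonnegative is extracted from the Berry-Esseen inequality
  itself: a distance is nonnegative and the bracket multiplying \<open>c\<close> is positive. This
  sign is needed before the bracket can be replaced by an upper bound.\<close>

lemma compound_poisson_kolmogorov_le:
  fixes PS :: "'s measure" and S :: "'s \<Rightarrow> real" and \<mu> :: "real measure"
  assumes be: "berry_esseen_const s d c" and d: "0 < d" "d \<le> 1" and s: "s \<ge> 0"
    and \<mu>: "prob_space \<mu>" "sets \<mu> = sets borel"
    and x: "integrable \<mu> (\<lambda>x. \<bar>x\<bar> powr (2 + d))"
    and lam: "lam > 0"
    and S: "prob_space PS" "S \<in> borel_measurable PS"
      "distr PS borel S = random_sum_law (measure_pmf (poisson_pmf lam)) \<mu>"
    and Z: "prob_space PZ" "distributed PZ lborel Z std_normal_density"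
  defines "m \<equiv> \<integral> x. x \<partial>\<mu>" and "q \<equiv> \<integral> x. x\<^sup>2 \<partial>\<mu>" and "b \<equiv> \<integral> x. \<bar>x\<bar> powr (2 + d) \<partial>\<mu>"
  assumes q: "q > 0"
  shows "c \<ge> 0"
    and "kolmogorov_dist PS (\<lambda>\<omega>. (S \<omega> - lam * m) / sqrt (lam * q)) PZ Z \<le>
      c / lam powr (d / 2) * (b / q powr (1 + d / 2))"
proof -
  define \<rho> where "\<rho> = kolmogorov_dist PS (\<lambda>\<omega>. (S \<omega> - lam * m) / sqrt (lam * q)) PZ Z"
  define h where "h n = lam / real n" for n :: nat
  define V where "V n = random_sum_law (measure_pmf (poisson_pmf (h n))) \<mu>" for n
  define L where "L n = (\<integral> v. \<bar>v - h n * m\<bar> powr (2 + d) \<partial>V n) / sqrt (h n * q) powr (2 + d)" for n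
  \<comment> \<open>\<open>G n\<close> is the bound on the centred moment divided by
    \<open>h n\<close>; it converges to \<open>b\<close>, since the correction factors tend to 1 and
    the term with \<open>m\<close> to 0.\<close>
  define G where "G n = (1 - sqrt (h n)) powr (1 - (2 + d)) * (1 + 3 * h n + (h n)\<^sup>2) * b
           + sqrt (h n) powr (2 + d - 1) * \<bar>m\<bar> powr (2 + d)" for n
  have [measurable]: "(\<lambda>x. x) \<in> borel_measurable \<mu>" using \<mu>(2) by (simp cong: measurable_cong_sets)
  interpret \<mu>: prob_space \<mu> by fact
  have x2: "integrable \<mu> (\<lambda>x. x\<^sup>2)" using \<mu>.integrable_powr_imp[OF _ x] d by auto
  have h0: "h \<longlonglongrightarrow> 0" unfolding h_def by (rule lim_const_over_n)
  have ev: "\<forall>\<^sub>F n in sequentially. n \<ge> 1 \<and> h n < 1"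
    using order_tendstoD(2)[OF h0, of 1] eventually_ge_at_top[of 1] by (intro eventually_conj) auto
  have step: "\<rho> \<le> c / real n powr (d / 2) * (L n + s)" if "n \<ge> 1" "h n < 1" for n
    unfolding \<rho>_def L_def V_def h_def m_def q_def
    using compound_poisson_kolmogorov_le_step[OF be d \<mu> x lam S Z that(1) that(2)[unfolded h_def]] q
    unfolding q_def by blast
  have L1: "L n > 0" and LG: "L n \<le> real n powr (d / 2) * (G n / (lam powr (d / 2) * q powr (1 + d / 2)))"
    if n: "n \<ge> 1" "h n < 1" for n
  proof -
    have hp: "h n > 0" using lam n by (simp add: h_def)
    interpret A: random_sum "measure_pmf (poisson_pmf (h n))" \<mu> by (rule random_sum_poisson[OF \<mu>])
    interpret V: prob_space "V n" unfolding V_def by (rule A.prob_R)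
    note mV = compound_poisson_moments[OF hp \<mu> x2, folded V_def m_def q_def]
    note cV = compound_poisson_centered_moment_le[OF hp n(2) \<mu> _ _ x, of m, folded V_def b_def]
    have sq: "sqrt (h n * q) powr (2 + d) = (h n * q) powr (1 + d / 2)"
    proof -
      have "sqrt (h n * q) powr (2 + d) = (h n * q) powr (1 / 2 * (2 + d))"
        using hp q by (subst powr_half_sqrt[symmetric]) (simp_all only: powr_powr, simp)
      also have "1 / 2 * (2 + d) = 1 + d / 2" by simp
      finally show ?thesis .
    qed
    have hq: "(h n * q) powr (1 + d / 2) > 0" using hp q by simp
    have "integrable (V n) (\<lambda>v. (v - h n * m)\<^sup>2)"
      using mV(1,2) by (simp add: power2_diff)
    \<comment> \<open>Lyapunov's inequality bounds the moment from below by a power of the positive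
      variance; this is what makes \<open>L n\<close> positive.\<close>
    then have "(h n * q) powr (1 + d / 2) \<le> (\<integral> v. \<bar>v - h n * m\<bar> powr (2 + d) \<partial>V n)"
      using V.expectation_powr_le[of "1 + d / 2" "\<lambda>v. (v - h n * m)\<^sup>2"] cV(1) d mV(4) by (simp add: square_powr_half)
    then have "(\<integral> v. \<bar>v - h n * m\<bar> powr (2 + d) \<partial>V n) > 0" using hq by linarith
    then show "L n > 0" unfolding L_def sq using hq by simp
    have "L n \<le> h n * G n / (h n * q) powr (1 + d / 2)"
      unfolding L_def sq G_def using cV(2) d hq by (intro divide_right_mono) auto
    also have "\<dots> = G n * (h n powr 1 / h n powr (1 + d / 2)) / q powr (1 + d / 2)"
      using hp q by (simp add: powr_mult)
    also have "h n powr 1 / h n powr (1 + d / 2) = h n powr (- (d / 2))"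
      by (simp only: powr_diff[symmetric]) simp
    also have "\<dots> = real n powr (d / 2) / lam powr (d / 2)"
      using n lam by (simp add: h_def powr_minus powr_divide)
    finally show "L n \<le> real n powr (d / 2) * (G n / (lam powr (d / 2) * q powr (1 + d / 2)))"
      by (simp add: mult_ac)
  qed
  obtain n where n: "n \<ge> 1" "h n < 1" using ev eventually_happens' sequentially_bot by blast
  have "0 \<le> \<rho>" unfolding \<rho>_def by (rule kolmogorov_dist_nonneg[OF S(1) Z(1)])
  also note step[OF n]
  also have "c / real n powr (d / 2) * (L n + s) = c * ((L n + s) / real n powr (d / 2))" by simp
  finally have "0 \<le> c * ((L n + s) / real n powr (d / 2))" .
  moreover have "(L n + s) / real n powr (d / 2) > 0" using L1[OF n] s n by simp
  ultimately show c: "c \<ge> 0" using zero_le_mult_iff[of c] by (auto simp del: times_divide_eq_right)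
  \<comment> \<open>The bound after cancelling n^(d/2): the ratio survives, while \<open>s\<close>
    acquires the factor n^(-d/2) and disappears in the limit.\<close>
  define a where "a n = c * (G n / (lam powr (d / 2) * q powr (1 + d / 2)) + s * real n powr (- (d / 2)))" for n
  have "\<rho> \<le> a n" if n: "n \<ge> 1" "h n < 1" for n
  proof -
    have np: "real n powr (d / 2) > 0" using n by simp
    have "\<rho> \<le> c / real n powr (d / 2) * (L n + s)" by (rule step[OF n])
    also have "\<dots> \<le> c / real n powr (d / 2) * (real n powr (d / 2) * (G n / (lam powr (d / 2) * q powr (1 + d / 2))) + s)"
      using c np by (intro mult_left_mono add_mono LG[OF n]) auto
    also have "\<dots> = a n" using np by (simp add: a_def powr_minus field_simps)
    finally show ?thesis .
  qed
  then have "\<forall>\<^sub>F n in sequentially. \<rho> \<le> a n" using ev by (auto elim: eventually_mono)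
  moreover have "a \<longlonglongrightarrow> c * (b / (lam powr (d / 2) * q powr (1 + d / 2)) + s * 0)"
  proof -
    have sh: "(\<lambda>n. sqrt (h n)) \<longlonglongrightarrow> 0" using tendsto_real_sqrt[OF h0] by simp
    have 1: "(\<lambda>n. (1 - sqrt (h n)) powr (1 - (2 + d))) \<longlonglongrightarrow> (1 - 0) powr (1 - (2 + d))"
      by (intro tendsto_powr tendsto_diff tendsto_const sh) simp
    have 2: "(\<lambda>n. sqrt (h n) powr (2 + d - 1)) \<longlonglongrightarrow> 0 powr (2 + d - 1)"
      using d lam by (intro tendsto_powr' sh tendsto_const) (auto simp: h_def)
    have "G \<longlonglongrightarrow> (1 - 0) powr (1 - (2 + d)) * (1 + 3 * 0 + 0\<^sup>2) * b + 0 powr (2 + d - 1) * \<bar>m\<bar> powr (2 + d)"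
      unfolding G_def by (intro tendsto_intros 1 2 h0)
    then have Gl: "G \<longlonglongrightarrow> b" by simp
    have "(\<lambda>n. real n powr (- (d / 2))) \<longlonglongrightarrow> 0"
      using d by (intro tendsto_neg_powr filterlim_real_sequentially) simp
    then show ?thesis
      unfolding a_def using lam q by (intro tendsto_intros Gl) auto
  qed
  ultimately have "\<rho> \<le> c * (b / (lam powr (d / 2) * q powr (1 + d / 2)) + s * 0)"
    by (intro tendsto_lowerbound) auto
  then show "kolmogorov_dist PS (\<lambda>\<omega>. (S \<omega> - lam * m) / sqrt (lam * q)) PZ Z \<le>
      c / lam powr (d / 2) * (b / q powr (1 + d / 2))"
    by (simp add: \<rho>_def)
qed

section \<open>Reduction to one compound Poisson sum, and the infimum of the constants\<close>

text \<open>{{N, Y}, X} and {N, {Y, X}} have the same law: both characteristic functions are the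
  generating function of N at that of Y at the characteristic function of X. With N Poisson this
  regroups the theorem's sum into Poisson many terms of law {Y, X}.\<close>

lemma random_sum_law_assoc:
  fixes \<nu> \<kappa> :: "nat measure" and \<mu> :: "real measure"
  assumes \<nu>: "prob_space \<nu>" "sets \<nu> = sets (count_space UNIV)"
    and \<kappa>: "prob_space \<kappa>" "sets \<kappa> = sets (count_space UNIV)"
    and \<mu>: "prob_space \<mu>" "sets \<mu> = sets borel"
  shows "random_sum_law (random_sum_law \<nu> \<kappa>) \<mu> = random_sum_law \<nu> (random_sum_law \<kappa> \<mu>)"
proof (rule Levy_uniqueness)
  interpret A: random_sum \<nu> \<kappa>
    using assms by (simp add: random_sum_def sets_borel_eq_count_space)
  have A_sets: "sets (random_sum_law \<nu> \<kappa>) = sets (count_space UNIV)"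
    by (simp add: A.sets_R sets_borel_eq_count_space)
  interpret B: random_sum "random_sum_law \<nu> \<kappa>" \<mu>
    using A.prob_R A_sets \<mu> by (simp add: random_sum_def)
  interpret C: random_sum \<kappa> \<mu>
    using \<kappa> \<mu> by (simp add: random_sum_def)
  interpret D: random_sum \<nu> "random_sum_law \<kappa> \<mu>"
    using \<nu> C.prob_R C.sets_R by (simp add: random_sum_def)
  interpret \<mu>: real_distribution \<mu> using \<mu> by (rule real_distributionI)
  show "real_distribution (random_sum_law (random_sum_law \<nu> \<kappa>) \<mu>)"
    by (intro real_distributionI B.prob_R B.sets_R)
  show "real_distribution (random_sum_law \<nu> (random_sum_law \<kappa> \<mu>))"
    by (intro real_distributionI D.prob_R D.sets_R)
  show "char (random_sum_law (random_sum_law \<nu> \<kappa>) \<mu>) = char (random_sum_law \<nu> (random_sum_law \<kappa> \<mu>))"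
  proof
    fix t
    have "char (random_sum_law (random_sum_law \<nu> \<kappa>) \<mu>) t = (\<integral> n. char \<mu> t ^ n \<partial>random_sum_law \<nu> \<kappa>)"
      by (rule char_random_sum[OF B.random_sum_axioms])
    also have "\<dots> = (\<integral> n. (\<integral> k. char \<mu> t ^ k \<partial>\<kappa>) ^ n \<partial>\<nu>)"
      by (rule A.integral_multiplicative)
         (auto simp: power_add norm_power power_le_one \<mu>.cmod_char_le_1
           measurable_cong_sets[OF sets_borel_eq_count_space refl])
    also have "\<dots> = char (random_sum_law \<nu> (random_sum_law \<kappa> \<mu>)) t"
      by (simp only: char_random_sum[OF C.random_sum_axioms] char_random_sum[OF D.random_sum_axioms])
    finally show "char (random_sum_law (random_sum_law \<nu> \<kappa>) \<mu>) t = char (random_sum_law \<nu> (random_sum_law \<kappa> \<mu>)) t" .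
  qed
qed

text \<open>Nonnegative values make the family bounded below, so that the \<open>INF\<close> of
  reals lies below each of its members.\<close>

lemma min_const_bounds:
  assumes "\<And>s. 0 \<le> s \<Longrightarrow> s \<le> 1 \<Longrightarrow> 0 \<le> C s d"
  shows "0 \<le> min_const C d" "\<lbrakk>0 \<le> s; s \<le> 1\<rbrakk> \<Longrightarrow> min_const C d \<le> C s d"
  unfolding min_const_def
proof -
  show "0 \<le> (INF s\<in>{0..1}. C s d)" by (rule cINF_greatest) (use assms in auto)
  show "(INF s\<in>{0..1}. C s d) \<le> C s d" if "0 \<le> s" "s \<le> 1"
    using that assms by (intro cINF_lower bdd_belowI2[of _ 0]) auto
qed

text \<open>The infimum need not be attained; it is enough that \<open>\<rho> / K\<close> is a lower
  bound of all the constants.\<close>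

lemma le_min_const_mult:
  assumes C: "\<And>s. 0 \<le> s \<Longrightarrow> s \<le> 1 \<Longrightarrow> \<rho> \<le> C s d * K" and K: "K > 0"
  shows "\<rho> \<le> min_const C d * K"
proof -
  have "\<rho> / K \<le> min_const C d"
    unfolding min_const_def by (rule cINF_greatest) (use C K in \<open>auto simp: field_simps\<close>)
  then show ?thesis using K by (simp add: field_simps)
qed

theorem mainTheorem1:
  fixes PX :: "'x measure" and X :: "'x \<Rightarrow> real"
    and PN :: "'n measure" and N :: "'n \<Rightarrow> nat"
    and PY :: "'y measure" and Y :: "'y \<Rightarrow> nat"
    and PS :: "'s measure" and S :: "'s \<Rightarrow> real"
    and PZ :: "'z measure" and Z :: "'z \<Rightarrow> real"
    and C :: "real \<Rightarrow> real \<Rightarrow> real"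
    and \<delta> a \<sigma> lam :: real and \<beta> :: "real \<Rightarrow> real"
  assumes C: "\<And>s d. s \<ge> 0 \<Longrightarrow> 0 < d \<Longrightarrow> d \<le> 1 \<Longrightarrow> berry_esseen_const s d (C s d)"
    and delta: "0 < \<delta>" "\<delta> \<le> 1"
    and X: "prob_space PX" "X \<in> borel_measurable PX"
    and X_moment: "integrable PX (\<lambda>\<omega>. \<bar>X \<omega>\<bar> powr (2 + \<delta>))"
      "prob_space.expectation PX (\<lambda>\<omega>. \<bar>X \<omega>\<bar> powr (2 + \<delta>)) > 0"
    and a: "a = prob_space.expectation PX X"
    and sigma: "\<sigma> \<ge> 0" "\<sigma>\<^sup>2 = prob_space.variance PX X"
    and beta: "\<And>r. 0 < r \<Longrightarrow> r \<le> 2 + \<delta> \<Longrightarrow>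
                 \<beta> r = prob_space.expectation PX (\<lambda>\<omega>. \<bar>X \<omega>\<bar> powr r)"
    and N: "prob_space PN" "N \<in> measurable PN (count_space UNIV)"
    and N_nondegenerate: "\<not> (AE \<omega> in PN. N \<omega> = 0)"
    and N_inf_div: "inf_divisible_nat (distr PN (count_space UNIV) N)"
    and Y: "prob_space PY" "Y \<in> measurable PY (count_space UNIV)" "AE \<omega> in PY. Y \<omega> > 0"
    and lam: "lam > 0"
    and N_repr: "distr PN (count_space UNIV) N =
                   random_sum_law (measure_pmf (poisson_pmf lam)) (distr PY (count_space UNIV) Y)"
    and Y_moment: "integrable PY (\<lambda>\<omega>. real (Y \<omega>) powr (2 + \<delta>))"
    and S: "prob_space PS" "S \<in> borel_measurable PS"
      "distr PS borel S = random_sum_law (distr PN (count_space UNIV) N) (distr PX borel X)"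
    and Z: "prob_space PZ" "distributed PZ lborel Z std_normal_density"
  shows "kolmogorov_dist PS
            (\<lambda>\<omega>. (S \<omega> - prob_space.expectation PS S) / sqrt (prob_space.variance PS S)) PZ Z
          \<le> min_const C \<delta> / lam powr (\<delta> / 2) *
             (\<beta> (2 + \<delta>) * prob_space.expectation PY (\<lambda>\<omega>. real (Y \<omega>) powr (2 + \<delta>)) /
              (\<sigma>\<^sup>2 * prob_space.expectation PY (\<lambda>\<omega>. real (Y \<omega>))
               + a\<^sup>2 * prob_space.expectation PY (\<lambda>\<omega>. (real (Y \<omega>))\<^sup>2)) powr (1 + \<delta> / 2))
       \<and> (a = 0 \<longrightarrow>
          kolmogorov_dist PS
            (\<lambda>\<omega>. S \<omega> / sqrt (lam * \<beta> 2 * prob_space.expectation PY (\<lambda>\<omega>. real (Y \<omega>)))) PZ Z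
          \<le> 1 / 2 * (1 + \<delta>) * (4 + \<delta>) * (min_const C \<delta> / lam powr (\<delta> / 2)) *
             (\<beta> (2 + \<delta>) / \<beta> 2 powr (1 + \<delta> / 2)) *
             (prob_space.expectation PY (\<lambda>\<omega>. real (Y \<omega>) powr (1 + \<delta> / 2)) /
              prob_space.expectation PY (\<lambda>\<omega>. real (Y \<omega>)) powr (1 + \<delta> / 2)))
       \<and> (\<delta> = 1 \<longrightarrow> a = 0 \<longrightarrow> C 0.646 1 \<le> 0.3031 \<longrightarrow>
          kolmogorov_dist PS
            (\<lambda>\<omega>. S \<omega> / sqrt (lam * \<beta> 2 * prob_space.expectation PY (\<lambda>\<omega>. real (Y \<omega>)))) PZ Z
          \<le> 1.5155 / sqrt lam * (\<beta> 3 / \<beta> 2 powr (3 / 2)) *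
             (prob_space.expectation PY (\<lambda>\<omega>. real (Y \<omega>) powr (3 / 2)) /
              prob_space.expectation PY (\<lambda>\<omega>. real (Y \<omega>)) powr (3 / 2)))"
proof -
  interpret PX: prob_space PX by fact
  interpret PY: prob_space PY by fact
  interpret PS: prob_space PS by fact
  define p where "p = 2 + \<delta>"
  have p: "p \<ge> 2" "p \<le> 3" using delta by (auto simp: p_def)
  define \<nu> where "\<nu> = distr PY (count_space UNIV) Y"
  define \<mu> where "\<mu> = distr PX borel X"
  define W where "W = random_sum_law \<nu> \<mu>"
  have \<nu>: "prob_space \<nu>" "sets \<nu> = sets (count_space UNIV)"
    unfolding \<nu>_def using Y(2) by (auto intro: PY.prob_space_distr)
  have \<mu>: "prob_space \<mu>" "sets \<mu> = sets borel"
    unfolding \<mu>_def using X(2) by (auto intro: PX.prob_space_distr)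
  interpret R: real_random_sum \<nu> \<mu>
    using \<nu> \<mu> by (simp add: real_random_sum_def random_sum_def)
  have W: "prob_space W" "sets W = sets borel"
    unfolding W_def by (fact R.prob_R R.sets_R)+
  have S_law: "distr PS borel S = random_sum_law (measure_pmf (poisson_pmf lam)) W"
    unfolding S N_repr W_def \<nu>_def[symmetric] \<mu>_def[symmetric]
    by (rule random_sum_law_assoc) (use \<nu> \<mu> in \<open>auto simp: measure_pmf.prob_space_axioms\<close>)

  have \<mu>_int: "(\<integral> x. f x \<partial>\<mu>) = (\<integral> \<omega>. f (X \<omega>) \<partial>PX)" "integrable \<mu> f \<longleftrightarrow> integrable PX (\<lambda>\<omega>. f (X \<omega>))"
    if "f \<in> borel_measurable borel" for f :: "real \<Rightarrow> real"
    unfolding \<mu>_def using X(2) that by (simp_all add: integral_distr integrable_distr_eq)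
  have \<nu>_int: "(\<integral> n. f n \<partial>\<nu>) = (\<integral> \<omega>. f (Y \<omega>) \<partial>PY)" "integrable \<nu> f \<longleftrightarrow> integrable PY (\<lambda>\<omega>. f (Y \<omega>))"
    for f :: "nat \<Rightarrow> real"
    unfolding \<nu>_def using Y(2) by (simp_all add: integral_distr integrable_distr_eq)
  have Ym [measurable]: "(\<lambda>\<omega>. real (Y \<omega>)) \<in> borel_measurable PY"
    using Y(2) by (rule measurable_compose) simp

  have X2: "integrable PX X" "integrable PX (\<lambda>\<omega>. (X \<omega>)\<^sup>2)"
    using PX.integrable_powr_imp[OF X(2) X_moment(1)] delta by auto
  have Yp: "integrable PY (\<lambda>\<omega>. \<bar>real (Y \<omega>)\<bar> powr (2 + \<delta>))" using Y_moment by simp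
  have Y2: "integrable PY (\<lambda>\<omega>. real (Y \<omega>))" "integrable PY (\<lambda>\<omega>. (real (Y \<omega>))\<^sup>2)"
    using PY.integrable_powr_imp[OF Ym Yp] delta by auto
  have Yh: "integrable PY (\<lambda>\<omega>. real (Y \<omega>) powr (1 + \<delta> / 2))"
    using PY.integrable_abs_powr_le[OF Ym Yp, of "1 + \<delta> / 2"] delta by simp
  have \<beta>p: "\<beta> p = (\<integral> x. \<bar>x\<bar> powr p \<partial>\<mu>)" "integrable \<mu> (\<lambda>x. \<bar>x\<bar> powr p)" "\<beta> p > 0"
    using beta[of p] X_moment delta by (auto simp: \<mu>_int p_def)
  have \<beta>2: "\<beta> 2 = (\<integral> x. x\<^sup>2 \<partial>\<mu>)" "integrable \<mu> (\<lambda>x. x\<^sup>2)"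
    using beta[of 2] X2 delta by (auto simp: \<mu>_int)
  have a_eq: "a = (\<integral> x. x \<partial>\<mu>)" by (simp add: a \<mu>_int)
  have \<sigma>_eq: "\<sigma>\<^sup>2 = \<beta> 2 - a\<^sup>2"
    unfolding sigma PX.variance_eq[OF X2] \<beta>2 a by (simp add: \<mu>_int)

  define EY EY2 where "EY = (\<integral> \<omega>. real (Y \<omega>) \<partial>PY)" and "EY2 = (\<integral> \<omega>. (real (Y \<omega>))\<^sup>2 \<partial>PY)"
  \<comment> \<open>A positive integer is at least 1. Consequently \<open>q\<close> is at least
    \<sigma>^2 + a^2 = \<beta> 2, which also covers a degenerate X with nonzero mean.\<close>
  have EY: "EY \<ge> 1" "EY2 \<ge> 1"
  proof -
    have "(\<integral> \<omega>. 1 \<partial>PY) \<le> EY" unfolding EY_def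
      by (rule integral_mono_AE) (use Y(3) Y2 in \<open>auto elim!: eventually_mono\<close>)
    then show "EY \<ge> 1" by (simp add: PY.prob_space)
    have "(\<integral> \<omega>. 1 \<partial>PY) \<le> EY2" unfolding EY2_def
      by (rule integral_mono_AE) (use Y(3) Y2 in \<open>auto elim!: eventually_mono simp: one_le_power\<close>)
    then show "EY2 \<ge> 1" by (simp add: PY.prob_space)
  qed
  have "\<beta> 2 > 0"
  proof (rule ccontr)
    assume "\<not> \<beta> 2 > 0"
    moreover have "0 \<le> (\<integral> \<omega>. (X \<omega>)\<^sup>2 \<partial>PX)" by simp
    ultimately have "(\<integral> \<omega>. (X \<omega>)\<^sup>2 \<partial>PX) = 0" by (simp add: \<beta>2 \<mu>_int)
    then have "AE \<omega> in PX. X \<omega> = 0"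
      using X2 by (subst (asm) integral_nonneg_eq_0_iff_AE) auto
    then have "(\<integral> \<omega>. \<bar>X \<omega>\<bar> powr (2 + \<delta>) \<partial>PX) = (\<integral> \<omega>. 0 \<partial>PX)"
      using X(2) by (intro integral_cong_AE) (auto elim!: eventually_mono)
    then show False using X_moment(2) by simp
  qed

  define m q b where "m = (\<integral> x. x \<partial>W)" and "q = (\<integral> x. x\<^sup>2 \<partial>W)" and "b = (\<integral> x. \<bar>x\<bar> powr (2 + \<delta>) \<partial>W)"
  have \<nu>2: "integrable \<nu> (\<lambda>n. (real n)\<^sup>2)" using Y2 by (simp add: \<nu>_int)
  note W_moments = R.moments_R[OF \<beta>2(2) \<nu>2, folded W_def a_eq \<beta>2(1) m_def q_def]
  have m_eq: "m = EY * a" using W_moments(3) by (simp add: \<nu>_int EY_def)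
  have q_eq: "q = \<sigma>\<^sup>2 * EY + a\<^sup>2 * EY2"
    using W_moments(4) by (simp add: q_def \<nu>_int EY_def EY2_def \<sigma>_eq mult.commute)
  have q: "q > 0"
  proof -
    have "\<sigma>\<^sup>2 * 1 + a\<^sup>2 * 1 \<le> q" unfolding q_eq using EY by (intro add_mono mult_left_mono) auto
    then show ?thesis using \<open>\<beta> 2 > 0\<close> \<sigma>_eq by simp
  qed
  have \<nu>p: "integrable \<nu> (\<lambda>n. real n powr p)" using Y_moment by (simp add: \<nu>_int p_def)
  have Wp: "integrable W (\<lambda>x. \<bar>x\<bar> powr (2 + \<delta>))"
    and b_le: "b \<le> (\<integral> \<omega>. real (Y \<omega>) powr (2 + \<delta>) \<partial>PY) * \<beta> (2 + \<delta>)"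
    using R.abs_moment_R[OF _ \<beta>p(2) \<nu>p] p \<beta>p(1) by (simp_all add: W_def b_def p_def \<nu>_int)

  have ES: "PS.expectation S = lam * m" and VS: "PS.variance S = lam * q"
  proof -
    note moments = compound_poisson_moments[OF lam W W_moments(2), folded S_law m_def q_def]
    show "PS.expectation S = lam * m" using moments(3) S(2) by (simp add: integral_distr)
    then show "PS.variance S = lam * q" using moments(4) S(2) by (simp add: integral_distr)
  qed
  define \<rho> where "\<rho> = kolmogorov_dist PS (\<lambda>\<omega>. (S \<omega> - lam * m) / sqrt (lam * q)) PZ Z"
  note be = C[OF _ delta]
  have C0: "C s \<delta> \<ge> 0" and \<rho>_le: "\<rho> \<le> C s \<delta> / lam powr (\<delta> / 2) * (b / q powr (1 + \<delta> / 2))"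
    if "0 \<le> s" for s
    using compound_poisson_kolmogorov_le[OF be[OF that] delta that W Wp lam S(1,2) S_law Z] q
    unfolding \<rho>_def m_def q_def b_def by blast+
  have M0: "min_const C \<delta> \<ge> 0" by (rule min_const_bounds) (rule C0)
  \<comment> \<open>Here \<open>u\<close> is any positive upper bound for E|W|^(2+\<delta>). The two
    cases of the theorem differ only in the choice of \<open>u\<close>.\<close>
  have bound: "\<rho> \<le> min_const C \<delta> / lam powr (\<delta> / 2) * (u / q powr (1 + \<delta> / 2))"
    if u: "b \<le> u" "u > 0" for u
  proof -
    have "\<rho> \<le> min_const C \<delta> * (u / (lam powr (\<delta> / 2) * q powr (1 + \<delta> / 2)))"
    proof (rule le_min_const_mult)
      fix s :: real assume s: "0 \<le> s" "s \<le> 1"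
      have "\<rho> \<le> C s \<delta> / lam powr (\<delta> / 2) * (b / q powr (1 + \<delta> / 2))" by (rule \<rho>_le[OF s(1)])
      also have "\<dots> \<le> C s \<delta> / lam powr (\<delta> / 2) * (u / q powr (1 + \<delta> / 2))"
        using u C0[OF s(1)] by (intro mult_left_mono divide_right_mono) auto
      finally show "\<rho> \<le> C s \<delta> * (u / (lam powr (\<delta> / 2) * q powr (1 + \<delta> / 2)))" by simp
    qed (use u lam q in simp)
    then show ?thesis by simp
  qed

  define EYp EYh where "EYp = (\<integral> \<omega>. real (Y \<omega>) powr (2 + \<delta>) \<partial>PY)"
    and "EYh = (\<integral> \<omega>. real (Y \<omega>) powr (1 + \<delta> / 2) \<partial>PY)"
  have EYh: "EYh \<ge> 1" and EYp: "EYp \<ge> 1"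
  proof -
    have "(\<integral> \<omega>. 1 \<partial>PY) \<le> EYh" unfolding EYh_def
      by (rule integral_mono_AE) (use Y(3) Yh delta in \<open>auto elim!: eventually_mono intro!: ge_one_powr_ge_zero\<close>)
    then show "EYh \<ge> 1" by (simp add: PY.prob_space)
    have "(\<integral> \<omega>. 1 \<partial>PY) \<le> EYp" unfolding EYp_def
      by (rule integral_mono_AE) (use Y(3) Y_moment delta in \<open>auto elim!: eventually_mono intro!: ge_one_powr_ge_zero\<close>)
    then show "EYp \<ge> 1" by (simp add: PY.prob_space)
  qed
  have part1: "\<rho> \<le> min_const C \<delta> / lam powr (\<delta> / 2) * (\<beta> (2 + \<delta>) * EYp / q powr (1 + \<delta> / 2))"
    using b_le EYp \<beta>p(3) by (intro bound) (auto simp: EYp_def[symmetric] p_def mult.commute)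

  have part2: "\<rho> \<le> 1 / 2 * (1 + \<delta>) * (4 + \<delta>) * (min_const C \<delta> / lam powr (\<delta> / 2)) *
             (\<beta> (2 + \<delta>) / \<beta> 2 powr (1 + \<delta> / 2)) * (EYh / EY powr (1 + \<delta> / 2))" if a0: "a = 0"
  proof -
    \<comment> \<open>\<open>K\<close> is the factor delivered by the Taylor argument and
      \<open>K'\<close> the one claimed; K' - K = \<delta>.\<close>
    define K where "K = (2 + \<delta>) * (1 + \<delta>) / 2 + 1"
    define K' where "K' = 1 / 2 * (1 + \<delta>) * (4 + \<delta>)"
    have KK': "K \<le> K'" using delta by (simp add: K_def K'_def field_simps)
    have K'0: "K' > 0" using delta by (simp add: K'_def)
    have "b \<le> (\<integral> n. K * real n powr (1 + \<delta> / 2) * \<beta> (2 + \<delta>) \<partial>\<nu>)"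
    proof -
      have "(\<integral> v. \<bar>\<bar>v\<bar> powr (2 + \<delta>)\<bar> \<partial>W) \<le> (\<integral> n. K * real n powr (1 + \<delta> / 2) * \<beta> (2 + \<delta>) \<partial>\<nu>)"
        unfolding W_def
      proof (rule R.R_integrable_bound)
        fix n
        show "integrable R.PX (\<lambda>x. \<bar>\<Sum>i = 1..n. x i\<bar> powr (2 + \<delta>))"
          using \<beta>p p by (intro R.abs_moment_sum(1)) (auto simp: p_def)
        show "(\<integral> x. \<bar>\<bar>\<Sum>i = 1..n. x i\<bar> powr (2 + \<delta>)\<bar> \<partial>R.PX) \<le> K * real n powr (1 + \<delta> / 2) * \<beta> (2 + \<delta>)"
          using R.abs_moment_sum_centered[OF delta, of n] \<beta>p a0 a_eq by (simp add: K_def p_def)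
      qed (use Yh in \<open>simp_all add: \<nu>_int\<close>)
      then show ?thesis by (simp add: b_def)
    qed
    also have "\<dots> = K * (EYh * \<beta> (2 + \<delta>))" by (simp add: \<nu>_int EYh_def)
    also have "\<dots> \<le> K' * (EYh * \<beta> (2 + \<delta>))"
      using KK' EYh \<beta>p(3) by (intro mult_right_mono) (auto simp: p_def)
    finally have "b \<le> K' * (EYh * \<beta> (2 + \<delta>))" .
    then have "\<rho> \<le> min_const C \<delta> / lam powr (\<delta> / 2) * (K' * (EYh * \<beta> (2 + \<delta>)) / q powr (1 + \<delta> / 2))"
      using K'0 EYh \<beta>p(3) by (intro bound) (auto simp: p_def)
    \<comment> \<open>For a = 0 the variance of X is \<beta> 2, so \<open>q\<close> reduces to the
      product of \<beta> 2 and \<open>EY\<close>.\<close>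
    also have "q powr (1 + \<delta> / 2) = \<beta> 2 powr (1 + \<delta> / 2) * EY powr (1 + \<delta> / 2)"
      using EY \<open>\<beta> 2 > 0\<close> by (simp add: q_eq \<sigma>_eq a0 powr_mult)
    finally show ?thesis by (simp add: K'_def mult_ac)
  qed

  have part3: "\<rho> \<le> 1.5155 / sqrt lam * (\<beta> 3 / \<beta> 2 powr (3 / 2)) * (EYh / EY powr (3 / 2))"
    if d1: "\<delta> = 1" and a0: "a = 0" and C1: "C 0.646 1 \<le> 0.3031"
  proof -
    have M: "min_const C 1 \<le> 0.3031"
      using min_const_bounds(2)[of C 1 "0.646"] C0 C1 d1 by force
    define T where "T = 1 / sqrt lam * (\<beta> 3 / \<beta> 2 powr (3 / 2)) * (EYh / EY powr (3 / 2))"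
    have T: "T \<ge> 0" using lam \<beta>p(3) EYh d1 by (simp add: T_def p_def)
    \<comment> \<open>At \<delta> = 1 the factor (1+\<delta>)(4+\<delta>)/2 is 5, and 5 times 0.3031
      is 1.5155.\<close>
    have "\<rho> \<le> 5 * min_const C 1 * T"
      using part2[OF a0] lam by (simp add: d1 T_def powr_half_sqrt)
    also have "\<dots> \<le> 1.5155 * T" using M T by (intro mult_right_mono) auto
    finally show ?thesis by (simp add: T_def)
  qed

  have \<rho>1: "\<rho> = kolmogorov_dist PS (\<lambda>\<omega>. (S \<omega> - PS.expectation S) / sqrt (PS.variance S)) PZ Z"
    unfolding \<rho>_def VS by (simp only: ES)
  \<comment> \<open>With a = 0 the centring vanishes and the variance is lam times \<beta> 2 times
    \<open>EY\<close>, so the normalisation of (ii) is the standard one.\<close>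
  have \<rho>2: "\<rho> = kolmogorov_dist PS (\<lambda>\<omega>. S \<omega> / sqrt (lam * \<beta> 2 * EY)) PZ Z" if "a = 0"
    unfolding \<rho>_def m_eq q_eq \<sigma>_eq that by (simp add: mult.assoc)
  show ?thesis
    unfolding EY_def[symmetric] EY2_def[symmetric] EYp_def[symmetric] EYh_def[symmetric] \<rho>1[symmetric]
  proof (intro conjI impI)
    show "\<rho> \<le> min_const C \<delta> / lam powr (\<delta> / 2) * (\<beta> (2 + \<delta>) * EYp / (\<sigma>\<^sup>2 * EY + a\<^sup>2 * EY2) powr (1 + \<delta> / 2))"
      using part1 by (simp only: q_eq)
  next
    assume a0: "a = 0"
    show "kolmogorov_dist PS (\<lambda>\<omega>. S \<omega> / sqrt (lam * \<beta> 2 * EY)) PZ Z \<le>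
      1 / 2 * (1 + \<delta>) * (4 + \<delta>) * (min_const C \<delta> / lam powr (\<delta> / 2)) *
             (\<beta> (2 + \<delta>) / \<beta> 2 powr (1 + \<delta> / 2)) * (EYh / EY powr (1 + \<delta> / 2))"
      using part2[OF a0] unfolding \<rho>2[OF a0] .
  next
    assume *: "\<delta> = 1" "a = 0" "C 0.646 1 \<le> 0.3031"
    have "EYh = (\<integral> \<omega>. real (Y \<omega>) powr (3 / 2) \<partial>PY)" unfolding EYh_def by (simp add: *(1))
    then show "kolmogorov_dist PS (\<lambda>\<omega>. S \<omega> / sqrt (lam * \<beta> 2 * EY)) PZ Z \<le>
      1.5155 / sqrt lam * (\<beta> 3 / \<beta> 2 powr (3 / 2)) *
        ((\<integral> \<omega>. real (Y \<omega>) powr (3 / 2) \<partial>PY) / EY powr (3 / 2))"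
      using part3[OF *] unfolding \<rho>2[OF *(2)] by simp
  qed
qed

end
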